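(* There is an open subset $\mathcal{O}$ of the $(e,t)$ plane $\mathbb{R}^2$, containing the segment $\{(e,t): e=\tfrac12,\ 0<t<\tfrac18\}$, such that for every $(e,t)\in\mathcal{O}$ the unique (up to measure-preserving transformations of $[0,1]$) graphon maximizing $S$ among all graphons $g$ with $\varepsilon(g)=e$ and $\tau(g)=t$ is $$g_{e,t}(x,y)=\begin{cases} e-(e^3-t)^{1/3}, & 0<x,y<\tfrac12 \ \text{ or }\ \tfrac12<x,y<1,\\ e+(e^3-t)^{1/3}, & x<\tfrac12<y\ \text{ or }\ y<\tfrac12<x.\end{cases}$$
   Context: A graphon is a measurable symmetric function $g:[0,1]^2\to[0,1]$, with functions identified when they agree almost everywhere. Its edge density, triangle density and entropy are $$\varepsilon(g)=\iint g(x,y)\,dx\,dy,\qquad \tau(g)=\iiint g(x,y)g(y,z)g(z,x)\,dx\,dy\,dz,\qquad S(g)=\iint H[g(x,y)]\,dx\,dy,$$ where $H(u)=-[u\ln u+(1-u)\ln(1-u)]$ for $u\in[0,1]$ (with $0\ln 0=0$). These quantities are invariant under measure-preserving transformations of $[0,1]$. Uniqueness "up to measure-preserving transformations" means: any two maximizers $g,h$ satisfy $g(\phi(x),\phi(y))=h(\psi(x),\psi(y))$ for a.e. $(x,y)$, for some measure-preserving maps $\phi,\psi:[0,1]\to[0,1]$. *)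

theory Defs
  imports "HOL-Analysis.Analysis"
begin

abbreviation unit_square :: "(real \<times> real) set" where
  "unit_square \<equiv> {0..1} \<times> {0..1}"

abbreviation unit_cube :: "(real \<times> real \<times> real) set" where
  "unit_cube \<equiv> {0..1} \<times> {0..1} \<times> {0..1}"

text \<open>
  Graphons are represented by functions that are constrained on the unit square only.
  There is no quotient by almost-everywhere equality: every class has a representative that is
  symmetric and [0,1]-valued everywhere on the square, the densities and the entropy do not
  depend on the representative, and uniqueness is stated almost everywhere.
\<close>

definition graphon :: "(real \<Rightarrow> real \<Rightarrow> real) \<Rightarrow> bool" where
  "graphon g \<longleftrightarrow>
     (\<lambda>(x, y). g x y) \<in> borel_measurable (lebesgue_on unit_square) \<and>
     (\<forall>x\<in>{0..1}. \<forall>y\<in>{0..1}. g x y = g y x) \<and>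
     (\<forall>x\<in>{0..1}. \<forall>y\<in>{0..1}. 0 \<le> g x y \<and> g x y \<le> 1)"

definition edge_density :: "(real \<Rightarrow> real \<Rightarrow> real) \<Rightarrow> real" where
  "edge_density g = (LINT (x, y)|lebesgue_on unit_square. g x y)"

definition triangle_density :: "(real \<Rightarrow> real \<Rightarrow> real) \<Rightarrow> real" where
  "triangle_density g = (LINT (x, y, z)|lebesgue_on unit_cube. g x y * g y z * g z x)"

text \<open>The convention \<open>0 ln 0 = 0\<close> holds automatically at both endpoints.\<close>

definition H :: "real \<Rightarrow> real" where
  "H u = - (u * ln u + (1 - u) * ln (1 - u))"

definition graphon_entropy :: "(real \<Rightarrow> real \<Rightarrow> real) \<Rightarrow> real" where
  "graphon_entropy g = (LINT (x, y)|lebesgue_on unit_square. H (g x y))"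

definition entropy_maximizer :: "real \<Rightarrow> real \<Rightarrow> (real \<Rightarrow> real \<Rightarrow> real) \<Rightarrow> bool" where
  "entropy_maximizer e t g \<longleftrightarrow>
     graphon g \<and> edge_density g = e \<and> triangle_density g = t \<and>
     (\<forall>h. graphon h \<and> edge_density h = e \<and> triangle_density h = t \<longrightarrow>
          graphon_entropy h \<le> graphon_entropy g)"

definition measure_preserving_unit :: "(real \<Rightarrow> real) \<Rightarrow> bool" where
  "measure_preserving_unit \<phi> \<longleftrightarrow>
     \<phi> \<in> measurable (lebesgue_on {0..1}) (lebesgue_on {0..1}) \<and>
     distr (lebesgue_on {0..1}) (lebesgue_on {0..1}) \<phi> = lebesgue_on {0..1}"

definition graphon_equiv ::
    "(real \<Rightarrow> real \<Rightarrow> real) \<Rightarrow> (real \<Rightarrow> real \<Rightarrow> real) \<Rightarrow> bool" where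
  "graphon_equiv g h \<longleftrightarrow>
     (\<exists>\<phi> \<psi>. measure_preserving_unit \<phi> \<and> measure_preserving_unit \<psi> \<and>
        (AE (x, y) in lebesgue_on unit_square. g (\<phi> x) (\<phi> y) = h (\<psi> x) (\<psi> y)))"

text \<open>
  On the null set where a coordinate equals \<open>1/2\<close> the value is immaterial and falls
  under the second case. \<open>root 3\<close> is the real cube root, defined on all of the reals.
\<close>

definition bipodal :: "real \<Rightarrow> real \<Rightarrow> real \<Rightarrow> real \<Rightarrow> real" where
  "bipodal e t x y =
     (if x < 1/2 \<and> y < 1/2 \<or> 1/2 < x \<and> 1/2 < y
      then e - root 3 (e ^ 3 - t)
      else e + root 3 (e ^ 3 - t))"

end

theory Submission
  imports Defs "HOL-Probability.Probability" "HOL-Real_Asymp.Real_Asymp"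
begin

text \<open>
  Write a graphon of edge density \<open>e\<close> as \<open>g = e + f\<close> with \<open>E f = 0\<close>, let
  \<open>d x = E f(x, y)\<close> be its centred degree, and put \<open>s = (e^3 - t)^(1/3) > 0\<close>. Expanding the
  triangle density turns the constraint \<open>\<tau> = t\<close> into
  \<open>E f(x,y) f(x,z) f(y,z) = - s^3 - 3 e E d^2\<close>: the kernel \<open>f\<close> must have a strongly negative
  triangle moment. The cheapest way to achieve this is a rank one kernel \<open>- s \<sigma>(x) \<sigma>(y)\<close> with
  \<open>\<sigma> = \<plusminus>1\<close> balanced, which is the bipodal graphon.

  On the entropy side, the fourth derivative of \<open>H\<close> is at most \<open>-32\<close>, so \<open>H (e + u)\<close> lies below
  its cubic Hermite interpolant at the nodes \<open>u = \<plusminus>s\<close> minus \<open>4/3 (u^2 - s^2)^2\<close>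
  (\<open>entropy_quartic_bound\<close>). Integrating this with \<open>E f = 0\<close> gives
  \<open>S(g) \<le> S\<^sub>0 - C (E f^2 - s^2) - 4/3 E (f^2 - s^2)^2 + K E f^3\<close>
  where \<open>S\<^sub>0\<close> is the entropy of the bipodal graphon, \<open>C \<ge> 2\<close>, and \<open>K\<close> vanishes at \<open>e = 1/2\<close>
  because \<open>H\<close> is symmetric about \<open>1/2\<close>. By Cauchy-Schwarz the triangle moment is at most
  \<open>(E f^2)^(3/2)\<close> in absolute value (\<open>triangle_squared_le\<close>), hence \<open>E f^2 \<ge> s^2\<close>, and for
  \<open>e = 1/2\<close> the maximum is settled.

  For \<open>e\<close> near \<open>1/2\<close> the constant \<open>K\<close> is small, and it suffices to bound \<open>E f^3\<close> linearly by the
  deficit \<open>E (f^2 - s^2)^2 + (E f^2 - s^2)\<close>. This is where the triangle constraint enters a second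
  time, through the stability of rank one kernels. For independent points \<open>x, y, z\<close> consider the
  residual \<open>r = f(y,z) + f(x,y) f(x,z) / s\<close>: the row of \<open>f\<close> at a random point \<open>x\<close> plays the
  part of the eigenvector of the integral operator. In \<open>E r^2\<close> the cross term is
  the triangle moment, and the constraint bounds \<open>E r^2\<close> and \<open>E d^2\<close> simultaneously by the deficit
  (\<open>residual_and_degree_le\<close>). Expanding the cube of \<open>f(y,z)\<close> around \<open>- f(x,y) f(x,z) / s\<close> and
  using \<open>E f = 0\<close>, every surviving term is of second order in \<open>r\<close>, \<open>f^2 - s^2\<close> and \<open>d\<close>
  (\<open>third_moment_le\<close>).

  So \<open>S(g) \<le> S\<^sub>0 - deficit / 3\<close> whenever \<open>K\<close> is small compared with a power of \<open>s\<close>, an open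
  condition on \<open>(e, t)\<close> that holds on the segment. For a maximizer the deficit vanishes, hence so
  does the residual, and freezing a typical \<open>x\<close> exhibits \<open>f\<close> as \<open>- s \<sigma>(y) \<sigma>(z)\<close>, with blocks of
  measure \<open>1/2\<close> since \<open>E f = 0\<close> (\<open>two_block_of_deficit_le_0\<close>). A quantile transform carries
  \<open>[0, 1/2)\<close> and \<open>(1/2, 1]\<close> onto these two blocks, so every maximizer pulls back to the same
  bipodal graphon.
\<close>

section \<open>A quartic upper bound for the entropy\<close>

lemma Rolle_real_derivative:
  fixes f :: "real \<Rightarrow> real"
  assumes "a < b" "f a = f b" "continuous_on {a..b} f"
    and d: "\<And>x. a < x \<Longrightarrow> x < b \<Longrightarrow> (f has_real_derivative f' x) (at x)"
  obtains z where "a < z" "z < b" "f' z = 0"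
proof -
  obtain z where z: "a < z" "z < b" "DERIV f z :> 0"
    using Rolle[of a b f] assms by (meson real_differentiable_def)
  have "f' z = 0" using d[OF z(1,2)] z(3) by (rule DERIV_unique)
  then show thesis using z that by blast
qed

lemma Rolle_real_derivative_inside:
  fixes f :: "real \<Rightarrow> real"
  assumes "a < b" "f a = f b" "l < a" "b < r"
    and d: "\<And>x. l < x \<Longrightarrow> x < r \<Longrightarrow> (f has_real_derivative f' x) (at x)"
  obtains z where "a < z" "z < b" "f' z = 0"
proof (rule Rolle_real_derivative[of a b f f'])
  show "continuous_on {a..b} f"
    using assms by (intro continuous_at_imp_continuous_on ballI DERIV_isCont[OF d]) auto
qed (use assms in \<open>auto intro: that\<close>)

text \<open>
  Rolle's theorem three times: four zeros of \<open>G1\<close> leave three zeros of its derivative, then two,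
  then one.
\<close>

lemma four_zeros_imp_zero_third_derivative:
  fixes G1 G2 G3 G4 :: "real \<Rightarrow> real"
  assumes "l < a" "a < b" "b < c" "c < d" "d < r"
    and "G1 a = 0" "G1 b = 0" "G1 c = 0" "G1 d = 0"
    and d1: "\<And>x. l < x \<Longrightarrow> x < r \<Longrightarrow> (G1 has_real_derivative G2 x) (at x)"
    and d2: "\<And>x. l < x \<Longrightarrow> x < r \<Longrightarrow> (G2 has_real_derivative G3 x) (at x)"
    and d3: "\<And>x. l < x \<Longrightarrow> x < r \<Longrightarrow> (G3 has_real_derivative G4 x) (at x)"
  obtains z where "l < z" "z < r" "G4 z = 0"
proof -
  obtain x1 where x1: "a < x1" "x1 < b" "G2 x1 = 0"
    using Rolle_real_derivative_inside[of a b G1 l r G2] assms by auto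
  obtain x2 where x2: "b < x2" "x2 < c" "G2 x2 = 0"
    using Rolle_real_derivative_inside[of b c G1 l r G2] assms by auto
  obtain x3 where x3: "c < x3" "x3 < d" "G2 x3 = 0"
    using Rolle_real_derivative_inside[of c d G1 l r G2] assms by auto
  obtain y1 where y1: "x1 < y1" "y1 < x2" "G3 y1 = 0"
    using Rolle_real_derivative_inside[of x1 x2 G2 l r G3] assms x1 x2 by auto
  obtain y2 where y2: "x2 < y2" "y2 < x3" "G3 y2 = 0"
    using Rolle_real_derivative_inside[of x2 x3 G2 l r G3] assms x2 x3 by auto
  obtain z where "y1 < z" "z < y2" "G4 z = 0"
    using Rolle_real_derivative_inside[of y1 y2 G3 l r G4] assms x1 x2 x3 y1 y2 by auto
  then show thesis using that[of z] assms x1 x2 x3 y1 y2 by auto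
qed

text \<open>
  Up to a positive factor, the error of cubic Hermite interpolation at two double nodes is a value
  of the fourth derivative, here \<open>F4\<close>. The point \<open>u\<close> may be an end point,
  where only continuity is assumed: this matters for the entropy, whose derivative is infinite at
  \<open>0\<close> and \<open>1\<close>, while the first use of Rolle's theorem needs derivatives in the interior only.
\<close>

lemma hermite_remainder_nonpos:
  fixes F0 F1 F2 F3 F4 :: "real \<Rightarrow> real"
  assumes lpqr: "l < p" "p < q" "q < r" and u: "u \<in> {l..r}"
    and cont: "continuous_on {l..r} F0"
    and d0: "\<And>x. l < x \<Longrightarrow> x < r \<Longrightarrow> (F0 has_real_derivative F1 x) (at x)"
    and d1: "\<And>x. l < x \<Longrightarrow> x < r \<Longrightarrow> (F1 has_real_derivative F2 x) (at x)"
    and d2: "\<And>x. l < x \<Longrightarrow> x < r \<Longrightarrow> (F2 has_real_derivative F3 x) (at x)"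
    and d3: "\<And>x. l < x \<Longrightarrow> x < r \<Longrightarrow> (F3 has_real_derivative F4 x) (at x)"
    and zeros: "F0 p = 0" "F0 q = 0" "F1 p = 0" "F1 q = 0"
    and neg: "\<And>x. l < x \<Longrightarrow> x < r \<Longrightarrow> F4 x \<le> 0"
  shows "F0 u \<le> 0"
proof (rule ccontr)
  assume "\<not> F0 u \<le> 0"
  then have pos: "F0 u > 0" by simp
  then have ne: "u \<noteq> p" "u \<noteq> q" using zeros by auto
  define k where "k = F0 u / ((u - p)\<^sup>2 * (u - q)\<^sup>2)"
  have k: "k > 0" unfolding k_def using pos ne by auto
  \<comment> \<open>Subtract the multiple of the quartic with double zeros \<open>p\<close>, \<open>q\<close> that creates a third zero at \<open>u\<close>.\<close>
  define G0 where "G0 v = F0 v - k * ((v - p)\<^sup>2 * (v - q)\<^sup>2)" for v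
  define G1 where "G1 v = F1 v - k * (2 * (v - p) * (v - q) * (2 * v - p - q))" for v
  define G2 where "G2 v = F2 v - k * (2 * (v - p)\<^sup>2 + 8 * (v - p) * (v - q) + 2 * (v - q)\<^sup>2)" for v
  define G3 where "G3 v = F3 v - k * (12 * (2 * v - p - q))" for v
  define G4 where "G4 v = F4 v - k * 24" for v
  have g0: "(G0 has_real_derivative G1 x) (at x)" if "l < x" "x < r" for x
    unfolding G0_def [abs_def] G1_def using d0[OF that]
    by (auto intro!: derivative_eq_intros simp: power2_eq_square algebra_simps)
  have g1: "(G1 has_real_derivative G2 x) (at x)" if "l < x" "x < r" for x
    unfolding G1_def [abs_def] G2_def using d1[OF that]
    by (auto intro!: derivative_eq_intros simp: power2_eq_square algebra_simps)
  have g2: "(G2 has_real_derivative G3 x) (at x)" if "l < x" "x < r" for x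
    unfolding G2_def [abs_def] G3_def using d2[OF that]
    by (auto intro!: derivative_eq_intros simp: power2_eq_square algebra_simps)
  have g3: "(G3 has_real_derivative G4 x) (at x)" if "l < x" "x < r" for x
    unfolding G3_def [abs_def] G4_def using d3[OF that]
    by (auto intro!: derivative_eq_intros simp: power2_eq_square algebra_simps)
  have contG: "continuous_on {l..r} G0"
    unfolding G0_def [abs_def] by (intro continuous_intros cont)
  have Gu: "G0 u = 0" unfolding G0_def k_def using ne by simp
  have Gpq: "G0 p = 0" "G0 q = 0" "G1 p = 0" "G1 q = 0" by (simp_all add: G0_def G1_def zeros)
  have rolle: "\<exists>z. a < z \<and> z < b \<and> G1 z = 0"
    if "a < b" "G0 a = 0" "G0 b = 0" "l \<le> a" "b \<le> r" for a b
  proof -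
    have "continuous_on {a..b} G0" by (rule continuous_on_subset[OF contG]) (use that in auto)
    then show ?thesis using Rolle_real_derivative[of a b G0 G1] g0 that by fastforce
  qed
  have "\<exists>z. l < z \<and> z < r \<and> G4 z = 0"
  proof -
    consider "u < p" | "p < u" "u < q" | "q < u" using ne by linarith
    then show ?thesis
    proof cases
      case 1
      obtain z1 where z1: "u < z1" "z1 < p" "G1 z1 = 0" using rolle[of u p] 1 Gu Gpq u lpqr by auto
      obtain z2 where z2: "p < z2" "z2 < q" "G1 z2 = 0" using rolle[of p q] 1 Gu Gpq u lpqr by auto
      show ?thesis
        by (rule four_zeros_imp_zero_third_derivative[of l z1 p z2 q r G1 G2 G3 G4])
           (use g1 g2 g3 z1 z2 Gpq u lpqr in auto)
    next
      case 2
      obtain z1 where z1: "p < z1" "z1 < u" "G1 z1 = 0" using rolle[of p u] 2 Gu Gpq u lpqr by auto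
      obtain z2 where z2: "u < z2" "z2 < q" "G1 z2 = 0" using rolle[of u q] 2 Gu Gpq u lpqr by auto
      show ?thesis
        by (rule four_zeros_imp_zero_third_derivative[of l p z1 z2 q r G1 G2 G3 G4])
           (use g1 g2 g3 z1 z2 Gpq u lpqr in auto)
    next
      case 3
      obtain z1 where z1: "p < z1" "z1 < q" "G1 z1 = 0" using rolle[of p q] 3 Gu Gpq u lpqr by auto
      obtain z2 where z2: "q < z2" "z2 < u" "G1 z2 = 0" using rolle[of q u] 3 Gu Gpq u lpqr by auto
      show ?thesis
        by (rule four_zeros_imp_zero_third_derivative[of l p z1 q z2 r G1 G2 G3 G4])
           (use g1 g2 g3 z1 z2 Gpq u lpqr in auto)
    qed
  qed
  then obtain z where "l < z" "z < r" "G4 z = 0" by blast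
  then show False using neg[of z] k unfolding G4_def by auto
qed

text \<open>
  The derivative of \<open>H\<close>, which is the negative of the usual logit function.
\<close>

definition logit where "logit x = ln (1 - x) - ln (x::real)"

lemma has_derivative_H:
  assumes "0 < x" "x < 1" shows "(H has_real_derivative logit x) (at x)"
proof -
  have "(1 - x) / (1 - x) = 1" using assms by simp
  then show ?thesis
    unfolding H_def [abs_def] logit_def using assms
    by (auto intro!: derivative_eq_intros)
qed

lemma has_derivative_logit:
  assumes "0 < x" "x < 1" shows "(logit has_real_derivative - (1/x) - 1/(1-x)) (at x)"
  unfolding logit_def [abs_def] using assms by (auto intro!: derivative_eq_intros simp: field_simps)

lemma continuous_on_H: "continuous_on {0..1} H"
proof -
  have 1: "continuous_on {0..1::real} (\<lambda>x. x * ln x)"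
    unfolding continuous_on_eq_continuous_within
  proof
    fix x :: real assume x: "x \<in> {0..1}"
    show "continuous (at x within {0..1}) (\<lambda>x. x * ln x)"
    proof (cases "x = 0")
      case True
      have "((\<lambda>x::real. x * ln x) \<longlongrightarrow> 0) (at_right 0)" by real_asymp
      then show ?thesis using True by (simp add: continuous_within at_within_Icc_at_right)
    next
      case False
      then show ?thesis using x by (intro continuous_intros) auto
    qed
  qed
  have 2: "continuous_on {0..1::real} (\<lambda>x. (1 - x) * ln (1 - x))"
    by (rule continuous_on_compose2[OF 1, of "{0..1}" "\<lambda>x. 1 - x"]) (auto intro!: continuous_intros)
  show ?thesis unfolding H_def [abs_def] by (intro continuous_intros 1 2)
qed

text \<open>
  By convexity \<open>1 / y^3\<close> lies above its tangent at \<open>y = 1/2\<close>, and the tangents at the symmetric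
  arguments \<open>x\<close> and \<open>1 - x\<close> add up to a constant.
\<close>

lemma inverse_cubes_ge_16:
  fixes x :: real assumes "0 < x" "x < 1" shows "16 \<le> 1 / x ^ 3 + 1 / (1 - x) ^ 3"
proof -
  have tangent: "32 - 48 * y \<le> 1 / y ^ 3" if "0 < y" for y :: real
  proof -
    \<comment> \<open>The double root at the point of tangency factors out.\<close>
    have "1 - (32 - 48 * y) * y ^ 3 = (2 * y - 1)\<^sup>2 * (12 * y\<^sup>2 + 4 * y + 1)"
      by (simp add: algebra_simps power2_eq_square power3_eq_cube)
    also have "\<dots> \<ge> 0" using that by simp
    finally have "(32 - 48 * y) * y ^ 3 \<le> 1" by simp
    then show ?thesis using that by (simp add: le_divide_eq)
  qed
  show ?thesis using tangent[of x] tangent[of "1 - x"] assms by simp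
qed

text \<open>
  The functions \<open>chord\<close>, \<open>curvature\<close> and \<open>skew\<close> are the coefficients of the cubic Hermite
  interpolant of \<open>H\<close> at \<open>e - s\<close> and \<open>e + s\<close>: the slope of the chord, the quadratic coefficient
  that matches the difference of the end slopes, and the cubic one, which matches what remains.
  As \<open>H\<close> is symmetric about \<open>1/2\<close>, the skewness is zero at \<open>e = 1/2\<close>; its size controls how far
  \<open>e\<close> may move away from \<open>1/2\<close>.
\<close>

definition skew where
  "skew e s = (logit (e + s) + logit (e - s)) / 2 - (H (e + s) - H (e - s)) / (2 * s)"

definition chord where "chord e s = (H (e + s) - H (e - s)) / (2 * s)"

definition curvature where "curvature e s = (logit (e - s) - logit (e + s)) / (4 * s)"

lemma curvature_ge_2:
  assumes "0 < s" "0 < e - s" "e + s < 1" shows "2 \<le> curvature e s"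
proof -
  obtain z where z: "e - s < z" "z < e + s"
    "logit (e + s) - logit (e - s) = (e + s - (e - s)) * (- (1/z) - 1/(1-z))"
    using MVT2[of "e - s" "e + s" logit "\<lambda>x. - (1/x) - 1/(1-x)"] has_derivative_logit assms by auto
  have zz: "0 < z" "z < 1" using z assms by auto
  have "0 \<le> (2 * z - 1)\<^sup>2" by simp
  then have "4 \<le> 1/z + 1/(1-z)" using zz by (simp add: field_simps power2_eq_square)
  moreover have "curvature e s = (1/z + 1/(1-z)) / 2"
  proof -
    have "logit (e - s) - logit (e + s) = (1/z + 1/(1-z)) * (2 * s)" using z(3) by argo
    then show ?thesis unfolding curvature_def using assms by simp
  qed
  ultimately show ?thesis by simp
qed

text \<open>
  The quartic has double zeros at both nodes, so adding a multiple of it to \<open>H\<close> preserves the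
  interpolation conditions; the factor \<open>4/3\<close> is the largest for which the fourth derivative,
  \<open>24 \<cdot> 4/3 = 32\<close>, is still compensated by that of \<open>H\<close>. It makes the bound strict away from
  the nodes.
\<close>

lemma entropy_quartic_bound:
  assumes s: "0 < s" "0 < e - s" "e + s < 1" and x: "0 \<le> x" "x \<le> 1"
  defines "v \<equiv> x - e"
  shows "H x \<le> (H (e + s) + H (e - s)) / 2 + chord e s * v - curvature e s * (v\<^sup>2 - s\<^sup>2)
           + skew e s / (2 * s\<^sup>2) * (v ^ 3 - s\<^sup>2 * v) - 4 / 3 * (v\<^sup>2 - s\<^sup>2)\<^sup>2"
proof -
  define A B C K where "A = (H (e + s) + H (e - s)) / 2" and "B = chord e s"
    and "C = curvature e s" and "K = skew e s / (2 * s\<^sup>2)"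
  define F0 where "F0 x = H x - (A + B * (x - e) - C * ((x - e)\<^sup>2 - s\<^sup>2)
     + K * ((x - e) ^ 3 - s\<^sup>2 * (x - e)) - 4 / 3 * ((x - e)\<^sup>2 - s\<^sup>2)\<^sup>2)" for x
  define F1 where "F1 x = logit x - (B - C * (2 * (x - e))
     + K * (3 * (x - e)\<^sup>2 - s\<^sup>2) - 16 / 3 * ((x - e) ^ 3 - s\<^sup>2 * (x - e)))" for x
  define F2 where "F2 x = - (1/x) - 1/(1-x) - (- C * 2
     + K * (6 * (x - e)) - 16 / 3 * (3 * (x - e)\<^sup>2 - s\<^sup>2))" for x
  define F3 where "F3 x = 1/x\<^sup>2 - 1/(1-x)\<^sup>2 - (6 * K - 32 * (x - e))" for x
  define F4 where "F4 x = - 2/x^3 - 2/(1-x)^3 + 32" for x :: real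
  have "F0 x \<le> 0"
  proof (rule hermite_remainder_nonpos[of 0 "e - s" "e + s" 1 x F0 F1 F2 F3 F4])
    show "continuous_on {0..1} F0"
      unfolding F0_def [abs_def] by (intro continuous_intros continuous_on_H)
    fix x :: real assume x: "0 < x" "x < 1"
    note [derivative_intros] = has_derivative_H[OF x] has_derivative_logit[OF x]
    show "(F0 has_real_derivative F1 x) (at x)"
      unfolding F0_def [abs_def] F1_def
      by (auto intro!: derivative_eq_intros simp: algebra_simps power2_eq_square power3_eq_cube)
    show "(F1 has_real_derivative F2 x) (at x)"
      unfolding F1_def [abs_def] F2_def
      by (auto intro!: derivative_eq_intros simp: algebra_simps power2_eq_square power3_eq_cube)
    show "(F2 has_real_derivative F3 x) (at x)"
      unfolding F2_def [abs_def] F3_def using x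
      by (auto intro!: derivative_eq_intros simp: power2_eq_square)
    have a: "((\<lambda>x. 1/x\<^sup>2) has_real_derivative - 2/x^3) (at x)"
      using x by (auto intro!: derivative_eq_intros simp: field_simps eval_nat_numeral)
    have b: "((\<lambda>x. 1/(1-x)\<^sup>2) has_real_derivative 2/(1-x)^3) (at x)"
      using x by (auto intro!: derivative_eq_intros simp: divide_simps eval_nat_numeral)
    have c: "((\<lambda>x. 6 * K - 32 * (x - e)) has_real_derivative - 32) (at x)"
      by (auto intro!: derivative_eq_intros)
    show "(F3 has_real_derivative F4 x) (at x)"
      unfolding F3_def [abs_def] F4_def
      by (rule DERIV_cong [OF DERIV_diff [OF DERIV_diff [OF a b] c]]) simp
    show "F4 x \<le> 0" unfolding F4_def using inverse_cubes_ge_16[OF x] by simp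
  next
    have s0: "s \<noteq> 0" using s by simp
    have B: "B * s * 2 = H (e + s) - H (e - s)" unfolding B_def chord_def using s0 by simp
    have K: "K * s\<^sup>2 * 2 = (logit (e + s) + logit (e - s)) / 2 - B"
      unfolding K_def B_def skew_def chord_def using s0 by simp
    have C: "C * s * 4 = logit (e - s) - logit (e + s)" unfolding C_def curvature_def using s0 by simp
    show "F0 (e - s) = 0" "F0 (e + s) = 0"
      unfolding F0_def using B by (simp_all add: A_def power2_eq_square power3_eq_cube field_simps)
    show "F1 (e - s) = 0" "F1 (e + s) = 0"
      unfolding F1_def using K C by (simp_all add: power2_eq_square power3_eq_cube field_simps)
  qed (use s x in auto)
  then show ?thesis unfolding F0_def v_def A_def B_def C_def K_def by simp
qed

section \<open>Expectations over two and three independent points\<close>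

text \<open>
  All moments below are integrals of polynomials in bounded kernels over a probability space. This
  class of functions is closed under the operations that occur and consists of integrable functions.
\<close>

definition bounded_measurable :: "'a measure \<Rightarrow> ('a \<Rightarrow> real) \<Rightarrow> bool" where
  "bounded_measurable N F \<longleftrightarrow> F \<in> borel_measurable N \<and> (\<exists>B. \<forall>x. \<bar>F x\<bar> \<le> B)"

named_theorems bdd_meas

lemma bdd_meas_const [bdd_meas]: "bounded_measurable N (\<lambda>x. c)"
  unfolding bounded_measurable_def by auto

lemma bdd_meas_add [bdd_meas]:
  assumes "bounded_measurable N F" "bounded_measurable N G"
  shows "bounded_measurable N (\<lambda>x. F x + G x)"
proof -
  obtain B C where "\<forall>x. \<bar>F x\<bar> \<le> B" "\<forall>x. \<bar>G x\<bar> \<le> C" using assms unfolding bounded_measurable_def by auto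
  then have "\<forall>x. \<bar>F x + G x\<bar> \<le> B + C" by (meson abs_triangle_ineq add_mono order_trans)
  then show ?thesis using assms unfolding bounded_measurable_def by (auto intro!: borel_measurable_add)
qed

lemma bdd_meas_mult [bdd_meas]:
  assumes "bounded_measurable N F" "bounded_measurable N G"
  shows "bounded_measurable N (\<lambda>x. F x * G x)"
proof -
  obtain B C where "\<forall>x. \<bar>F x\<bar> \<le> B" "\<forall>x. \<bar>G x\<bar> \<le> C" using assms unfolding bounded_measurable_def by auto
  then have "\<forall>x. \<bar>F x * G x\<bar> \<le> B * C" by (metis abs_ge_zero abs_mult mult_mono' )
  then show ?thesis using assms unfolding bounded_measurable_def by (auto intro!: borel_measurable_times)
qed

lemma bdd_meas_minus [bdd_meas]: "bounded_measurable N F \<Longrightarrow> bounded_measurable N (\<lambda>x. - F x)"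
  using bdd_meas_mult[OF bdd_meas_const[of N "-1"]] by simp

lemma bdd_meas_diff [bdd_meas]:
  "bounded_measurable N F \<Longrightarrow> bounded_measurable N G \<Longrightarrow> bounded_measurable N (\<lambda>x. F x - G x)"
  using bdd_meas_add[OF _ bdd_meas_minus] by simp

lemma bdd_meas_power [bdd_meas]: "bounded_measurable N F \<Longrightarrow> bounded_measurable N (\<lambda>x. F x ^ n)"
  by (induction n) (auto intro: bdd_meas)

lemma bdd_meas_divide [bdd_meas]: "bounded_measurable N F \<Longrightarrow> bounded_measurable N (\<lambda>x. F x / c)"
  using bdd_meas_mult[OF _ bdd_meas_const[of N "inverse c"]] by (simp add: divide_inverse)

lemma bdd_meas_compose:
  assumes "bounded_measurable N F" "T \<in> measurable L N"
  shows "bounded_measurable L (\<lambda>x. F (T x))"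
  using assms unfolding bounded_measurable_def by (auto intro: measurable_compose)

lemma (in finite_measure) bdd_meas_integrable:
  "bounded_measurable M F \<Longrightarrow> integrable M F"
  unfolding bounded_measurable_def using integrable_const_bound[of F] by fastforce

lemma (in prob_space) bdd_meas_section:
  assumes "bounded_measurable (N \<Otimes>\<^sub>M M) (\<lambda>(x, y). F x y)"
  shows "bounded_measurable N (\<lambda>x. \<integral>y. F x y \<partial>M)"
proof -
  obtain B where B: "\<And>x y. \<bar>F x y\<bar> \<le> B" and m[measurable]: "(\<lambda>(x, y). F x y) \<in> borel_measurable (N \<Otimes>\<^sub>M M)"
    using assms unfolding bounded_measurable_def by auto
  have "B \<ge> 0" using B[of undefined undefined] by simp
  have "\<bar>\<integral>y. F x y \<partial>M\<bar> \<le> B" for x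
  proof (cases "integrable M (F x)")
    case True
    have "\<bar>\<integral>y. F x y \<partial>M\<bar> \<le> (\<integral>y. \<bar>F x y\<bar> \<partial>M)" by (rule integral_abs_bound)
    also have "\<dots> \<le> (\<integral>y. B \<partial>M)" by (rule integral_mono) (use True B in auto)
    finally show ?thesis by (simp add: prob_space)
  qed (use \<open>B \<ge> 0\<close> in \<open>simp add: not_integrable_integral_eq\<close>)
  then show ?thesis unfolding bounded_measurable_def by auto
qed

lemma Cauchy_Schwarz_integral:
  fixes u v :: "'a \<Rightarrow> real"
  assumes i: "integrable M (\<lambda>x. (u x)\<^sup>2)" "integrable M (\<lambda>x. (v x)\<^sup>2)" "integrable M (\<lambda>x. u x * v x)"
  shows "(\<integral>x. u x * v x \<partial>M)\<^sup>2 \<le> (\<integral>x. (u x)\<^sup>2 \<partial>M) * (\<integral>x. (v x)\<^sup>2 \<partial>M)"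
proof -
  define a b c where "a = (\<integral>x. (u x)\<^sup>2 \<partial>M)" and "b = (\<integral>x. u x * v x \<partial>M)" and "c = (\<integral>x. (v x)\<^sup>2 \<partial>M)"
  have key: "0 \<le> r\<^sup>2 * a - 2 * (r * t) * b + t\<^sup>2 * c" for r t
  proof -
    have "0 \<le> (\<integral>x. (r * u x - t * v x)\<^sup>2 \<partial>M)" by simp
    also have "\<dots> = (\<integral>x. r\<^sup>2 * (u x)\<^sup>2 - 2 * (r * t) * (u x * v x) + t\<^sup>2 * (v x)\<^sup>2 \<partial>M)"
      by (simp add: power2_eq_square algebra_simps)
    also have "\<dots> = r\<^sup>2 * a - 2 * (r * t) * b + t\<^sup>2 * c"
      using i by (simp add: a_def b_def c_def)
    finally show ?thesis .
  qed
  have "0 \<le> c" unfolding c_def by simp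
  have "b\<^sup>2 \<le> a * c"
  proof (cases "c = 0")
    case True
    have "b = 0"
    proof (rule ccontr)
      assume "b \<noteq> 0"
      \<comment> \<open>With this parameter the quadratic form takes the value \<open>-1\<close>.\<close>
      then show False using key[of 1 "(a + 1) / (2 * b)"] True by simp
    qed
    then show ?thesis using True by simp
  next
    case False
    have "0 \<le> c * (a * c - b\<^sup>2)" using key[of c b] by (simp add: power2_eq_square algebra_simps)
    then show ?thesis using False \<open>0 \<le> c\<close> by (simp add: zero_le_mult_iff)
  qed
  then show ?thesis by (simp add: a_def b_def c_def)
qed

context prob_space
begin

interpretation MM: pair_prob_space M M ..

interpretation MMM: pair_prob_space M "M \<Otimes>\<^sub>M M" ..

text \<open>
  With iterated integrals written as expectations over independent points of law \<open>M\<close>, identities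
  between moments of a kernel amount to permuting, dropping or integrating out points.
\<close>

definition E2 :: "('a \<Rightarrow> 'a \<Rightarrow> real) \<Rightarrow> real" where
  "E2 F = (\<integral>(x, y). F x y \<partial>(M \<Otimes>\<^sub>M M))"

definition E3 :: "('a \<Rightarrow> 'a \<Rightarrow> 'a \<Rightarrow> real) \<Rightarrow> real" where
  "E3 F = (\<integral>(x, y, z). F x y z \<partial>(M \<Otimes>\<^sub>M M \<Otimes>\<^sub>M M))"

abbreviation bdd_meas2 where "bdd_meas2 F \<equiv> bounded_measurable (M \<Otimes>\<^sub>M M) (\<lambda>(x, y). F x y)"

abbreviation bdd_meas3 where "bdd_meas3 F \<equiv> bounded_measurable (M \<Otimes>\<^sub>M M \<Otimes>\<^sub>M M) (\<lambda>(x, y, z). F x y z)"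

text \<open>
  The closure rules of \<open>bounded_measurable\<close> match a function applied to one variable, hence tuple
  abstractions have to be replaced by projections before they apply.
\<close>

lemma bdd_meas_split2:
  "bdd_meas2 F \<longleftrightarrow> bounded_measurable (M \<Otimes>\<^sub>M M) (\<lambda>p. F (fst p) (snd p))"
  by (simp add: case_prod_unfold)

lemma bdd_meas_split3:
  "bdd_meas3 F \<longleftrightarrow> bounded_measurable (M \<Otimes>\<^sub>M M \<Otimes>\<^sub>M M) (\<lambda>p. F (fst p) (fst (snd p)) (snd (snd p)))"
  by (simp add: case_prod_unfold)

lemma bdd_meas3_pair:
  assumes "bdd_meas2 F"
  shows "bdd_meas3 (\<lambda>x y z. F x y)" "bdd_meas3 (\<lambda>x y z. F x z)" "bdd_meas3 (\<lambda>x y z. F y z)"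
proof -
  have *: "bounded_measurable (M \<Otimes>\<^sub>M M \<Otimes>\<^sub>M M) (\<lambda>p. F (S p) (T p))"
    if "S \<in> measurable (M \<Otimes>\<^sub>M M \<Otimes>\<^sub>M M) M" "T \<in> measurable (M \<Otimes>\<^sub>M M \<Otimes>\<^sub>M M) M" for S T
    using bdd_meas_compose[OF assms, of "\<lambda>p. (S p, T p)" "M \<Otimes>\<^sub>M M \<Otimes>\<^sub>M M"] that by simp
  show "bdd_meas3 (\<lambda>x y z. F x y)" "bdd_meas3 (\<lambda>x y z. F x z)" "bdd_meas3 (\<lambda>x y z. F y z)"
    unfolding bdd_meas_split3 by (rule *; measurable)+
qed

lemma E2_iterated: "bdd_meas2 F \<Longrightarrow> E2 F = (\<integral>x. \<integral>y. F x y \<partial>M \<partial>M)"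
  unfolding E2_def
  using MM.integral_fst'[OF MM.bdd_meas_integrable, of "\<lambda>(x, y). F x y"] by simp

lemma E2_swap: "bdd_meas2 F \<Longrightarrow> E2 (\<lambda>x y. F y x) = E2 F"
  unfolding E2_def
  using MM.integral_product_swap[of "\<lambda>(x, y). F x y"] unfolding bounded_measurable_def
  by (simp add: case_prod_unfold)

lemma bdd_meas2_section:
  assumes "bdd_meas3 F" "x \<in> space M" shows "bdd_meas2 (F x)"
proof -
  have "(\<lambda>q. (x, q)) \<in> measurable (M \<Otimes>\<^sub>M M) (M \<Otimes>\<^sub>M M \<Otimes>\<^sub>M M)" using assms(2) by measurable
  from bdd_meas_compose[OF assms(1) this] show ?thesis by (simp add: case_prod_unfold)
qed

lemma E3_fst: "bdd_meas3 F \<Longrightarrow> E3 F = (\<integral>x. E2 (F x) \<partial>M)"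
  unfolding E3_def E2_def
  using MMM.integral_fst'[OF MMM.bdd_meas_integrable, of "\<lambda>(x, y, z). F x y z"]
  by (simp add: case_prod_unfold)

lemma E3_iterated:
  assumes "bdd_meas3 F" shows "E3 F = (\<integral>x. \<integral>y. \<integral>z. F x y z \<partial>M \<partial>M \<partial>M)"
  unfolding E3_fst[OF assms]
  by (intro Bochner_Integration.integral_cong refl E2_iterated bdd_meas2_section[OF assms])

lemma bdd_meas_permute23:
  assumes "bdd_meas3 F" shows "bdd_meas3 (\<lambda>x y z. F x z y)"
proof -
  have "(\<lambda>(x, y, z). (x, z, y)) \<in> measurable (M \<Otimes>\<^sub>M M \<Otimes>\<^sub>M M) (M \<Otimes>\<^sub>M M \<Otimes>\<^sub>M M)" by measurable
  from bdd_meas_compose[OF assms this] show ?thesis by (simp add: case_prod_unfold)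
qed

lemma E3_permute23:
  assumes "bdd_meas3 F" shows "E3 (\<lambda>x y z. F x z y) = E3 F"
  unfolding E3_fst[OF assms] E3_fst[OF bdd_meas_permute23[OF assms]]
  by (intro Bochner_Integration.integral_cong refl E2_swap bdd_meas2_section[OF assms])

lemma E3_integral_last:
  assumes "bdd_meas3 F"
  shows "bdd_meas2 (\<lambda>x y. \<integral>z. F x y z \<partial>M)" "E3 F = E2 (\<lambda>x y. \<integral>z. F x y z \<partial>M)"
proof -
  have "(\<lambda>p. (fst (fst p), snd (fst p), snd p)) \<in> measurable ((M \<Otimes>\<^sub>M M) \<Otimes>\<^sub>M M) (M \<Otimes>\<^sub>M M \<Otimes>\<^sub>M M)" by measurable
  from bdd_meas_compose[OF assms this]
  have "bounded_measurable ((M \<Otimes>\<^sub>M M) \<Otimes>\<^sub>M M) (\<lambda>(p, z). F (fst p) (snd p) z)" by (simp add: case_prod_unfold)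
  from bdd_meas_section[OF this] show b: "bdd_meas2 (\<lambda>x y. \<integral>z. F x y z \<partial>M)" by (simp add: case_prod_unfold)
  show "E3 F = E2 (\<lambda>x y. \<integral>z. F x y z \<partial>M)"
    unfolding E3_iterated[OF assms] E2_iterated[OF b] ..
qed

lemma bdd_meas_permute12:
  assumes "bdd_meas3 F" shows "bdd_meas3 (\<lambda>x y z. F y x z)"
proof -
  have "(\<lambda>(x, y, z). (y, x, z)) \<in> measurable (M \<Otimes>\<^sub>M M \<Otimes>\<^sub>M M) (M \<Otimes>\<^sub>M M \<Otimes>\<^sub>M M)" by measurable
  from bdd_meas_compose[OF assms this] show ?thesis by (simp add: case_prod_unfold)
qed

lemma E3_permute12:
  assumes "bdd_meas3 F" shows "E3 (\<lambda>x y z. F y x z) = E3 F"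
  unfolding E3_integral_last(2)[OF assms] E3_integral_last(2)[OF bdd_meas_permute12[OF assms]]
  using E2_swap[OF E3_integral_last(1)[OF assms]] .

lemma E3_const: "E3 (\<lambda>x y z. c) = c"
  unfolding E3_def by (simp add: case_prod_unfold MMM.prob_space)

lemma E3_add: "bdd_meas3 F \<Longrightarrow> bdd_meas3 G \<Longrightarrow> E3 (\<lambda>x y z. F x y z + G x y z) = E3 F + E3 G"
  unfolding E3_def bdd_meas_split3 by (simp add: case_prod_unfold MMM.bdd_meas_integrable)

lemma E3_diff: "bdd_meas3 F \<Longrightarrow> bdd_meas3 G \<Longrightarrow> E3 (\<lambda>x y z. F x y z - G x y z) = E3 F - E3 G"
  unfolding E3_def bdd_meas_split3 by (simp add: case_prod_unfold MMM.bdd_meas_integrable)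

lemma E3_cmult: "E3 (\<lambda>x y z. c * F x y z) = c * E3 F"
  unfolding E3_def by (simp add: case_prod_unfold)

lemma E3_mono:
  "bdd_meas3 F \<Longrightarrow> bdd_meas3 G \<Longrightarrow> (\<And>x y z. F x y z \<le> G x y z) \<Longrightarrow> E3 F \<le> E3 G"
  unfolding E3_def bdd_meas_split3 by (auto simp add: case_prod_unfold intro!: integral_mono MMM.bdd_meas_integrable)

lemma E3_abs_le:
  assumes "bdd_meas3 F" "bdd_meas3 G" "\<And>x y z. \<bar>F x y z\<bar> \<le> G x y z" shows "\<bar>E3 F\<bar> \<le> E3 G"
proof -
  have "E3 F \<le> E3 G" using assms by (intro E3_mono) (auto simp: abs_le_iff)
  moreover have "E3 (\<lambda>x y z. 0 - G x y z) \<le> E3 F" using assms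
    by (intro E3_mono) (auto simp: abs_le_iff bdd_meas_split3 minus_le_iff intro: bdd_meas)
  then have "- E3 G \<le> E3 F" unfolding E3_def by (simp add: case_prod_unfold)
  ultimately show ?thesis by (simp add: abs_le_iff)
qed

lemma E3_marginals:
  assumes F: "bdd_meas2 F"
  shows "E3 (\<lambda>x y z. F x y) = E2 F" "E3 (\<lambda>x y z. F x z) = E2 F" "E3 (\<lambda>x y z. F y z) = E2 F"
proof -
  show 1: "E3 (\<lambda>x y z. F x y) = E2 F"
    using E3_integral_last(2)[OF bdd_meas3_pair(1)[OF F]] by (simp add: prob_space)
  show "E3 (\<lambda>x y z. F x z) = E2 F"
    using E3_permute23[OF bdd_meas3_pair(1)[OF F]] 1 by simp
  show "E3 (\<lambda>x y z. F y z) = E2 F"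
    using E3_fst[OF bdd_meas3_pair(3)[OF F]] by (simp add: prob_space)
qed

text \<open>
  Conditionally on the first point, the other two are independent.
\<close>

lemma E3_product:
  assumes "bdd_meas2 F" "bdd_meas2 G"
  shows "E3 (\<lambda>x y z. F x y * G x z) = (\<integral>x. (\<integral>y. F x y \<partial>M) * (\<integral>z. G x z \<partial>M) \<partial>M)"
proof -
  have "bdd_meas3 (\<lambda>x y z. F x y * G x z)"
    using bdd_meas3_pair[OF assms(1)] bdd_meas3_pair[OF assms(2)] unfolding bdd_meas_split3 by (intro bdd_meas)
  then show ?thesis by (simp add: E3_iterated)
qed

end

text \<open>
  A null set of pairs, seen through any two of three independent points, is a null set of triples.
\<close>

lemma (in prob_space) AE_triple:
  assumes "AE p in M \<Otimes>\<^sub>M M. P (fst p) (snd p)"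
  shows "AE p in M \<Otimes>\<^sub>M M \<Otimes>\<^sub>M M. P (fst p) (fst (snd p)) \<and> P (fst p) (snd (snd p)) \<and> P (fst (snd p)) (snd (snd p))"
proof -
  interpret MM: pair_prob_space M M ..
  interpret MMM: pair_prob_space M "M \<Otimes>\<^sub>M M" ..
  obtain N where N: "N \<in> null_sets (M \<Otimes>\<^sub>M M)" "{p \<in> space (M \<Otimes>\<^sub>M M). \<not> P (fst p) (snd p)} \<subseteq> N"
    using assms by (auto elim!: AE_E3)
  define F where "F x y = (indicator N (x, y) :: real)" for x y
  have bF: "bdd_meas2 F" unfolding bounded_measurable_def F_def using N(1)
    by (auto simp: indicator_def case_prod_unfold null_sets_def intro!: exI[of _ 1])
  have "E2 F = 0"
  proof -
    have "E2 F = (\<integral>p. indicator N p \<partial>(M \<Otimes>\<^sub>M M))" unfolding E2_def F_def by (simp add: case_prod_unfold)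
    also have "\<dots> = 0" using N(1) by (simp add: measure_def null_sets_def)
    finally show ?thesis .
  qed
  then have z: "E3 (\<lambda>x y z. F x y) = 0" "E3 (\<lambda>x y z. F x z) = 0" "E3 (\<lambda>x y z. F y z) = 0"
    using E3_marginals[OF bF] by auto
  have ae: "AE p in M \<Otimes>\<^sub>M M \<Otimes>\<^sub>M M. G (fst p) (fst (snd p)) (snd (snd p)) = 0"
    if "bdd_meas3 G" "E3 G = 0" "\<And>x y z. 0 \<le> G x y z" for G
  proof -
    have "integrable (M \<Otimes>\<^sub>M M \<Otimes>\<^sub>M M) (\<lambda>p. G (fst p) (fst (snd p)) (snd (snd p)))"
      using that(1) unfolding bdd_meas_split3 by (rule MMM.bdd_meas_integrable)
    from integral_nonneg_eq_0_iff_AE[OF this] that(2,3) show ?thesis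
      unfolding E3_def by (simp add: case_prod_unfold)
  qed
  have nn: "0 \<le> F x y" for x y unfolding F_def by simp
  have "AE p in M \<Otimes>\<^sub>M M \<Otimes>\<^sub>M M. F (fst p) (fst (snd p)) = 0"
    "AE p in M \<Otimes>\<^sub>M M \<Otimes>\<^sub>M M. F (fst p) (snd (snd p)) = 0"
    "AE p in M \<Otimes>\<^sub>M M \<Otimes>\<^sub>M M. F (fst (snd p)) (snd (snd p)) = 0"
    using ae[of "\<lambda>x y z. F x y"] ae[of "\<lambda>x y z. F x z"] ae[of "\<lambda>x y z. F y z"] z bdd_meas3_pair[OF bF] nn
    by auto
  with AE_space show ?thesis
    by eventually_elim (use N(2) in \<open>auto simp: F_def space_pair_measure indicator_def split: if_splits\<close>)
qed

lemma (in prob_space) AE_both: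
  assumes "AE x in M. P x"
  shows "AE p in M \<Otimes>\<^sub>M M. P (fst p) \<and> P (snd p)"
proof -
  interpret MM: pair_prob_space M M ..
  obtain N where N: "N \<in> null_sets M" "{x \<in> space M. \<not> P x} \<subseteq> N" using assms by (auto elim!: AE_E3)
  have "N \<times> space M \<in> null_sets (M \<Otimes>\<^sub>M M)" "space M \<times> N \<in> null_sets (M \<Otimes>\<^sub>M M)"
    using N(1) by (auto simp: null_sets_def emeasure_pair_measure_Times)
  then have "AE p in M \<Otimes>\<^sub>M M. p \<notin> N \<times> space M" "AE p in M \<Otimes>\<^sub>M M. p \<notin> space M \<times> N"
    by (auto intro: AE_not_in)
  with AE_space show ?thesis
    by eventually_elim (use N(2) in \<open>auto simp: space_pair_measure mem_Times_iff\<close>)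
qed

section \<open>Kernels with a prescribed triangle moment\<close>

text \<open>
  Here \<open>a\<close>, \<open>b\<close> stand for \<open>f(x,y)\<close>, \<open>f(x,z)\<close> and \<open>f\<close> for \<open>f(y,z)\<close>. The terms subtracted
  from \<open>f ^ 3\<close> are those of order at most one in \<open>w\<close>, \<open>\<alpha>\<close>, \<open>\<beta>\<close>; they are not small pointwise,
  but their expectations are.
\<close>

lemma cube_rank_one_expansion:
  fixes f a b s :: real
  assumes s: "0 < s" "s \<le> 1" and bd: "\<bar>f\<bar> \<le> 1" "\<bar>a\<bar> \<le> 1" "\<bar>b\<bar> \<le> 1"
  defines "w \<equiv> f + a * b / s" and "\<alpha> \<equiv> a\<^sup>2 - s\<^sup>2" and "\<beta> \<equiv> b\<^sup>2 - s\<^sup>2"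
  shows "\<bar>f ^ 3 - s\<^sup>2 * f - 2 * s\<^sup>2 * w - (\<alpha> + \<beta>) * f\<bar> \<le> 9 / (2 * s ^ 3) * (\<alpha>\<^sup>2 + \<beta>\<^sup>2) + 4 / s * w\<^sup>2"
proof -
  define r where "r = a * b / s"
  have r2: "r\<^sup>2 = s\<^sup>2 + \<alpha> + \<beta> + \<alpha> * \<beta> / s\<^sup>2"
    unfolding r_def \<alpha>_def \<beta>_def using s by (simp add: field_simps power2_eq_square)
  have f: "f = w - r" unfolding w_def r_def by simp
  \<comment> \<open>The first summand, \<open>3 r\<^sup>2 w - r ^ 3\<close>, is the expansion of \<open>(w - r) ^ 3\<close> to first order in \<open>w\<close>.\<close>
  have "f ^ 3 = r\<^sup>2 * (f + 2 * w) + w\<^sup>2 * (3 * f - 2 * w)"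
    unfolding f by (simp add: power2_eq_square power3_eq_cube algebra_simps)
  then have eq: "f ^ 3 - s\<^sup>2 * f - 2 * s\<^sup>2 * w - (\<alpha> + \<beta>) * f =
      2 * (\<alpha> + \<beta>) * w + \<alpha> * \<beta> * ((f + 2 * w) / s\<^sup>2) + w\<^sup>2 * (3 * f - 2 * w)"
    unfolding r2 using s by (simp add: field_simps)
  have rb: "\<bar>r\<bar> \<le> 1 / s" unfolding r_def using s mult_mono[OF bd(2,3)] by (simp add: abs_mult field_simps)
  have s1: "1 \<le> 1 / s" using s by simp
  have "(1/s)\<^sup>2 \<ge> 1" "(1/s)^3 \<ge> 1" using s1 by (simp_all add: one_le_power del: power_one_over)
  then have s3: "1 \<le> 1 / s ^ 3" by (simp add: power_divide)
  have b1: "\<bar>2 * (\<alpha> + \<beta>) * w\<bar> \<le> 2 * (\<alpha>\<^sup>2 + \<beta>\<^sup>2) + w\<^sup>2"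
  proof -
    have "2 * \<bar>\<alpha> + \<beta>\<bar> * \<bar>w\<bar> \<le> \<bar>\<alpha> + \<beta>\<bar>\<^sup>2 + \<bar>w\<bar>\<^sup>2" by (rule sum_squares_bound)
    moreover have "0 \<le> (\<alpha> - \<beta>)\<^sup>2" by simp
    then have "(\<alpha> + \<beta>)\<^sup>2 \<le> 2 * (\<alpha>\<^sup>2 + \<beta>\<^sup>2)" by (simp add: power2_eq_square algebra_simps)
    moreover have "\<bar>2 * (\<alpha> + \<beta>) * w\<bar> = 2 * \<bar>\<alpha> + \<beta>\<bar> * \<bar>w\<bar>" by (simp only: abs_mult abs_numeral)
    ultimately show ?thesis by simp
  qed
  have b2: "\<bar>\<alpha> * \<beta> * ((f + 2 * w) / s\<^sup>2)\<bar> \<le> (\<alpha>\<^sup>2 + \<beta>\<^sup>2) * (5 / (2 * s ^ 3))"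
  proof -
    have "2 * \<bar>\<alpha>\<bar> * \<bar>\<beta>\<bar> \<le> \<bar>\<alpha>\<bar>\<^sup>2 + \<bar>\<beta>\<bar>\<^sup>2" by (rule sum_squares_bound)
    then have 1: "\<bar>\<alpha> * \<beta>\<bar> \<le> (\<alpha>\<^sup>2 + \<beta>\<^sup>2) / 2" by (simp add: abs_mult)
    have "\<bar>f + 2 * w\<bar> \<le> 5 / s" using rb bd s1 f by (simp add: abs_if split: if_splits)
    then have "\<bar>(f + 2 * w) / s\<^sup>2\<bar> \<le> 5 / s / s\<^sup>2" 
      using divide_right_mono[of "\<bar>f + 2 * w\<bar>" "5 / s" "s\<^sup>2"] by simp
    also have "\<dots> = 5 / s ^ 3" by (simp add: power2_eq_square power3_eq_cube)
    finally have "\<bar>\<alpha> * \<beta>\<bar> * \<bar>(f + 2 * w) / s\<^sup>2\<bar> \<le> (\<alpha>\<^sup>2 + \<beta>\<^sup>2) / 2 * (5 / s ^ 3)"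
      by (intro mult_mono 1) auto
    then show ?thesis by (simp add: abs_mult)
  qed
  have b3: "\<bar>w\<^sup>2 * (3 * f - 2 * w)\<bar> \<le> w\<^sup>2 * (3 / s)"
  proof -
    have "\<bar>3 * f - 2 * w\<bar> \<le> 3 / s" using rb bd s1 f by (simp add: abs_if split: if_splits)
    from mult_left_mono[OF this, of "w\<^sup>2"] show ?thesis by (simp add: abs_mult)
  qed
  have c1: "2 * (\<alpha>\<^sup>2 + \<beta>\<^sup>2) \<le> (\<alpha>\<^sup>2 + \<beta>\<^sup>2) * (4 / (2 * s ^ 3))"
    using mult_left_mono[OF s3, of "2 * (\<alpha>\<^sup>2 + \<beta>\<^sup>2)"] by (simp add: algebra_simps)
  have c2: "w\<^sup>2 \<le> w\<^sup>2 * (1 / s)" using mult_left_mono[OF s1, of "w\<^sup>2"] by simp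
  have "\<bar>f ^ 3 - s\<^sup>2 * f - 2 * s\<^sup>2 * w - (\<alpha> + \<beta>) * f\<bar>
     \<le> (\<alpha>\<^sup>2 + \<beta>\<^sup>2) * (4 / (2 * s ^ 3)) + w\<^sup>2 * (1 / s) + (\<alpha>\<^sup>2 + \<beta>\<^sup>2) * (5 / (2 * s ^ 3)) + w\<^sup>2 * (3 / s)"
    unfolding eq using b1 b2 b3 c1 c2 by linarith
  also have "\<dots> = 9 / (2 * s ^ 3) * (\<alpha>\<^sup>2 + \<beta>\<^sup>2) + 4 / s * w\<^sup>2"
    using s by (simp add: field_simps)
  finally show ?thesis .
qed

text \<open>
  The kernel \<open>f\<close> is a centred graphon \<open>g - e\<close>, and \<open>s\<close> is the absolute value that it would take
  if it were bipodal.
\<close>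

locale bounded_symmetric_kernel = prob_space M for M :: "'a measure" +
  fixes f :: "'a \<Rightarrow> 'a \<Rightarrow> real" and s :: real
  assumes kernel_measurable: "(\<lambda>(x, y). f x y) \<in> borel_measurable (M \<Otimes>\<^sub>M M)"
    and kernel_sym: "\<And>x y. f x y = f y x"
    and kernel_bound: "\<And>x y. \<bar>f x y\<bar> \<le> 1"
    and s: "0 < s" "s \<le> 1"
begin

interpretation MM: pair_prob_space M M ..

interpretation MMM: pair_prob_space M "M \<Otimes>\<^sub>M M" ..

text \<open>
  The triangle moment is the trace of the third power of the integral operator of \<open>f\<close>. In
  \<open>residual\<close>, the rank one kernel built from the row of \<open>f\<close> at \<open>x\<close> is compared with \<open>f\<close>; it
  vanishes identically if \<open>f(y,z) = - s \<sigma>(y) \<sigma>(z)\<close> with \<open>\<sigma> = \<plusminus>1\<close>.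
\<close>

definition "energy = E2 (\<lambda>x y. (f x y)\<^sup>2)"
definition "spread = E2 (\<lambda>x y. ((f x y)\<^sup>2 - s\<^sup>2)\<^sup>2)"
definition "mean_sq_degree = E3 (\<lambda>x y z. f x y * f x z)"
definition "triangle_moment = E3 (\<lambda>x y z. f x y * f x z * f y z)"
definition "residual x y z = f y z + f x y * f x z / s"
definition "mean_sq_residual = E3 (\<lambda>x y z. (residual x y z)\<^sup>2)"

lemma bdd_meas2_kernel: "bdd_meas2 f"
  unfolding bounded_measurable_def using kernel_measurable kernel_bound by auto

lemmas bdd_meas_kernel = bdd_meas2_kernel[unfolded bdd_meas_split2] bdd_meas3_pair[OF bdd_meas2_kernel, unfolded bdd_meas_split3]

lemma mean_sq_degree_eq: "mean_sq_degree = (\<integral>x. (\<integral>y. f x y \<partial>M)\<^sup>2 \<partial>M)"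
  unfolding mean_sq_degree_def E3_product[OF bdd_meas2_kernel bdd_meas2_kernel] by (simp add: power2_eq_square)

lemma mean_sq_degree_nonneg: "0 \<le> mean_sq_degree"
  unfolding mean_sq_degree_eq by simp

lemma mean_sq_residual_nonneg: "0 \<le> mean_sq_residual"
  unfolding mean_sq_residual_def E3_def by (simp add: case_prod_unfold)

text \<open>
  Two applications of Cauchy-Schwarz: with \<open>q\<close> the square of the operator, the triangle moment is
  the inner product of \<open>f\<close> and \<open>q\<close>, and \<open>q(x,y)\<^sup>2\<close> is at most the product of the squared norms of
  the rows at \<open>x\<close> and \<open>y\<close>.
\<close>

lemma triangle_squared_le: "triangle_moment\<^sup>2 \<le> energy ^ 3"
proof -
  define q where "q x y = (\<integral>z. f x z * f y z \<partial>M)" for x y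
  define p where "p x = (\<integral>y. (f x y)\<^sup>2 \<partial>M)" for x
  have f2: "bdd_meas2 (\<lambda>x y. (f x y)\<^sup>2)" unfolding bdd_meas_split2 by (intro bdd_meas bdd_meas_kernel)
  have int1: "integrable M (f x)" "integrable M (\<lambda>y. (f x y)\<^sup>2)" "integrable M (\<lambda>z. f x z * f y z)"
    if "x \<in> space M" "y \<in> space M" for x y
  proof -
    have b: "bounded_measurable M (f x)" if "x \<in> space M" for x
      using bdd_meas_compose[OF bdd_meas2_kernel, of "\<lambda>y. (x, y)" M] that by simp
    show "integrable M (f x)" "integrable M (\<lambda>y. (f x y)\<^sup>2)" "integrable M (\<lambda>z. f x z * f y z)"
      by (intro bdd_meas_integrable bdd_meas b that)+
  qed
  have bq: "bdd_meas2 q" unfolding q_def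
    by (rule E3_integral_last(1)) (unfold bdd_meas_split3, intro bdd_meas bdd_meas_kernel)
  have bp: "bounded_measurable M p" unfolding p_def by (rule bdd_meas_section[OF f2])
  have b3: "bdd_meas3 (\<lambda>x y z. f x y * (f x z * f y z))" unfolding bdd_meas_split3 by (intro bdd_meas bdd_meas_kernel)
  have T: "triangle_moment = E2 (\<lambda>x y. f x y * q x y)"
    unfolding triangle_moment_def mult.assoc E3_integral_last(2)[OF b3] q_def by simp
  have pp: "bdd_meas2 (\<lambda>x y. p x * p y)"
    unfolding bdd_meas_split2 by (intro bdd_meas bdd_meas_compose[OF bp]) measurable
  have N: "energy = (\<integral>x. p x \<partial>M)" unfolding energy_def E2_iterated[OF f2] p_def ..
  have "triangle_moment\<^sup>2 \<le> energy * E2 (\<lambda>x y. (q x y)\<^sup>2)"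
  proof -
    have "(\<integral>p. case_prod f p * case_prod q p \<partial>(M \<Otimes>\<^sub>M M))\<^sup>2 \<le>
      (\<integral>p. (case_prod f p)\<^sup>2 \<partial>(M \<Otimes>\<^sub>M M)) * (\<integral>p. (case_prod q p)\<^sup>2 \<partial>(M \<Otimes>\<^sub>M M))"
      by (intro Cauchy_Schwarz_integral MM.bdd_meas_integrable bdd_meas bdd_meas2_kernel bq)
    then show ?thesis unfolding T energy_def E2_def by (simp add: case_prod_unfold)
  qed
  also have "\<dots> \<le> energy * E2 (\<lambda>x y. p x * p y)"
  proof (rule mult_left_mono)
    show "E2 (\<lambda>x y. (q x y)\<^sup>2) \<le> E2 (\<lambda>x y. p x * p y)" unfolding E2_def
    proof (rule integral_mono)
      show "integrable (M \<Otimes>\<^sub>M M) (\<lambda>(x, y). (q x y)\<^sup>2)"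
        using bq unfolding bdd_meas_split2 by (auto intro!: MM.bdd_meas_integrable bdd_meas simp: case_prod_unfold)
      show "integrable (M \<Otimes>\<^sub>M M) (\<lambda>(x, y). p x * p y)" by (rule MM.bdd_meas_integrable[OF pp])
      fix r assume "r \<in> Sigma_Algebra.space (M \<Otimes>\<^sub>M M)"
      then show "(case r of (x, y) \<Rightarrow> (q x y)\<^sup>2) \<le> (case r of (x, y) \<Rightarrow> p x * p y)"
        using int1 unfolding q_def p_def
        by (auto simp: space_pair_measure intro!: Cauchy_Schwarz_integral)
    qed
    show "0 \<le> energy" unfolding energy_def E2_def by (simp add: case_prod_unfold)
  qed
  also have "E2 (\<lambda>x y. p x * p y) = energy * energy" unfolding N E2_iterated[OF pp] by simp
  finally show ?thesis by (simp add: power3_eq_cube)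
qed

lemma bdd_meas2_squares: "bdd_meas2 (\<lambda>x y. (f x y)\<^sup>2 - s\<^sup>2)" "bdd_meas2 (\<lambda>x y. (f x y)\<^sup>2)" "bdd_meas2 (\<lambda>x y. ((f x y)\<^sup>2 - s\<^sup>2)\<^sup>2)"
  unfolding bdd_meas_split2 by (intro bdd_meas bdd_meas_kernel)+

lemmas marginals =
  E3_marginals[OF bdd_meas2_kernel] E3_marginals[OF bdd_meas2_squares(2), folded energy_def]
  E3_marginals[OF bdd_meas2_squares(3), folded spread_def]

lemma bdd_meas_residual:
  "bounded_measurable (M \<Otimes>\<^sub>M M \<Otimes>\<^sub>M M) (\<lambda>p. residual (fst p) (fst (snd p)) (snd (snd p)))"
  unfolding residual_def by (intro bdd_meas bdd_meas_kernel)

lemmas E3_linear = E3_add E3_diff E3_cmult E3_const bdd_meas_split3 bdd_meas bdd_meas_kernel bdd_meas_residual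

text \<open>
  The square of the residual is expanded. Its cross term is the triangle moment, and the square of
  the rank one term, \<open>f(x,y)\<^sup>2 f(x,z)\<^sup>2 / s\<^sup>2\<close>, is linearized at \<open>s\<^sup>2\<close> with an error bounded by the
  spread.
\<close>

lemma mean_sq_residual_le: "mean_sq_residual \<le> 3 * energy - s\<^sup>2 + 2 / s * triangle_moment + spread / s\<^sup>2"
proof -
  have "mean_sq_residual \<le> E3 (\<lambda>x y z. (f y z)\<^sup>2 + (f x y)\<^sup>2 + (f x z)\<^sup>2 - s\<^sup>2
     + 2 / s * (f x y * f x z * f y z)
     + 1 / (2 * s\<^sup>2) * (((f x y)\<^sup>2 - s\<^sup>2)\<^sup>2 + ((f x z)\<^sup>2 - s\<^sup>2)\<^sup>2))"
    unfolding mean_sq_residual_def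
  proof (rule E3_mono)
    fix x y z
    define a b c where "a = f x y" and "b = f x z" and "c = f y z"
    have "0 \<le> (a\<^sup>2 - b\<^sup>2)\<^sup>2" by simp
    then have "a\<^sup>2 * b\<^sup>2 \<le> s\<^sup>2 * (a\<^sup>2 + b\<^sup>2 - s\<^sup>2) + ((a\<^sup>2 - s\<^sup>2)\<^sup>2 + (b\<^sup>2 - s\<^sup>2)\<^sup>2) / 2"
      by (simp add: power2_eq_square field_simps)
    then have "a\<^sup>2 * b\<^sup>2 / s\<^sup>2 \<le> (s\<^sup>2 * (a\<^sup>2 + b\<^sup>2 - s\<^sup>2) + ((a\<^sup>2 - s\<^sup>2)\<^sup>2 + (b\<^sup>2 - s\<^sup>2)\<^sup>2) / 2) / s\<^sup>2"
      by (rule divide_right_mono) simp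
    also have "\<dots> = a\<^sup>2 + b\<^sup>2 - s\<^sup>2 + 1 / (2 * s\<^sup>2) * ((a\<^sup>2 - s\<^sup>2)\<^sup>2 + (b\<^sup>2 - s\<^sup>2)\<^sup>2)"
      using s by (simp add: add_divide_distrib)
    finally have "c\<^sup>2 + 2 / s * (a * b * c) + a\<^sup>2 * b\<^sup>2 / s\<^sup>2 \<le>
       c\<^sup>2 + a\<^sup>2 + b\<^sup>2 - s\<^sup>2 + 2 / s * (a * b * c) + 1 / (2 * s\<^sup>2) * ((a\<^sup>2 - s\<^sup>2)\<^sup>2 + (b\<^sup>2 - s\<^sup>2)\<^sup>2)"
      by simp
    moreover have "(residual x y z)\<^sup>2 = c\<^sup>2 + 2 / s * (a * b * c) + a\<^sup>2 * b\<^sup>2 / s\<^sup>2"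
      unfolding residual_def a_def b_def c_def by (simp add: power2_sum power_divide power_mult_distrib)
    ultimately show "(residual x y z)\<^sup>2 \<le> (f y z)\<^sup>2 + (f x y)\<^sup>2 + (f x z)\<^sup>2 - s\<^sup>2
     + 2 / s * (f x y * f x z * f y z)
     + 1 / (2 * s\<^sup>2) * (((f x y)\<^sup>2 - s\<^sup>2)\<^sup>2 + ((f x z)\<^sup>2 - s\<^sup>2)\<^sup>2)"
      by (simp add: a_def b_def c_def)
  qed (unfold bdd_meas_split3, (intro bdd_meas bdd_meas_kernel bdd_meas_residual)+)
  also have "\<dots> = 3 * energy - s\<^sup>2 + 2 / s * triangle_moment + 1 / (2 * s\<^sup>2) * (2 * spread)"
    unfolding triangle_moment_def by (simp only: E3_linear marginals) simp
  finally show ?thesis by simp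
qed

text \<open>
  Given \<open>x\<close>, the two factors are independent, so that only their conditional means count; that of
  \<open>f(x,z)\<close> is the degree. This gains a square over a pointwise estimate.
\<close>

lemma degree_covariance_le:
  "\<bar>E3 (\<lambda>x y z. ((f x y)\<^sup>2 - s\<^sup>2) * f x z)\<bar> \<le> (spread + mean_sq_degree) / 2"
proof -
  define A where "A x = (\<integral>y. ((f x y)\<^sup>2 - s\<^sup>2) \<partial>M)" for x
  define d where "d x = (\<integral>y. f x y \<partial>M)" for x
  have bA: "bounded_measurable M A" unfolding A_def by (rule bdd_meas_section[OF bdd_meas2_squares(1)])
  have bd: "bounded_measurable M d" unfolding d_def by (rule bdd_meas_section[OF bdd_meas2_kernel])
  have mean_square: "u * v \<le> 1 / 2 * (u\<^sup>2 + v\<^sup>2)" for u v :: real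
    using sum_squares_bound[of u v] by (simp add: field_simps)
  \<comment> \<open>The second moment of the conditional mean \<open>A\<close> is a correlation of two copies of \<open>f\<^sup>2 - s\<^sup>2\<close>.\<close>
  have "E3 (\<lambda>x y z. ((f x y)\<^sup>2 - s\<^sup>2) * ((f x z)\<^sup>2 - s\<^sup>2)) \<le>
      E3 (\<lambda>x y z. 1 / 2 * (((f x y)\<^sup>2 - s\<^sup>2)\<^sup>2 + ((f x z)\<^sup>2 - s\<^sup>2)\<^sup>2))"
  proof (rule E3_mono)
    fix x y z
    show "((f x y)\<^sup>2 - s\<^sup>2) * ((f x z)\<^sup>2 - s\<^sup>2) \<le> 1 / 2 * (((f x y)\<^sup>2 - s\<^sup>2)\<^sup>2 + ((f x z)\<^sup>2 - s\<^sup>2)\<^sup>2)"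
      using mean_square[of "(f x y)\<^sup>2 - s\<^sup>2" "(f x z)\<^sup>2 - s\<^sup>2"] .
  qed (unfold bdd_meas_split3, (intro bdd_meas bdd_meas_kernel)+)
  also have "\<dots> = spread" by (simp only: E3_linear marginals) simp
  finally have A2: "(\<integral>x. (A x)\<^sup>2 \<partial>M) \<le> spread"
    unfolding E3_product[OF bdd_meas2_squares(1) bdd_meas2_squares(1)] by (simp add: A_def power2_eq_square)
  have int: "integrable M (\<lambda>x. (A x)\<^sup>2)" "integrable M (\<lambda>x. (d x)\<^sup>2)" "integrable M (\<lambda>x. A x * d x)"
    by (intro bdd_meas_integrable bdd_meas bA bd)+
  have "\<bar>\<integral>x. A x * d x \<partial>M\<bar> \<le> (\<integral>x. \<bar>A x * d x\<bar> \<partial>M)" by (rule integral_abs_bound)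
  also have "\<dots> \<le> (\<integral>x. ((A x)\<^sup>2 + (d x)\<^sup>2) / 2 \<partial>M)"
  proof (rule integral_mono)
    show "integrable M (\<lambda>x. \<bar>A x * d x\<bar>)" using int(3) by (rule integrable_abs)
    show "integrable M (\<lambda>x. ((A x)\<^sup>2 + (d x)\<^sup>2) / 2)" using int by auto
    show "\<bar>A x * d x\<bar> \<le> ((A x)\<^sup>2 + (d x)\<^sup>2) / 2" for x
      using sum_squares_bound[of "\<bar>A x\<bar>" "\<bar>d x\<bar>"] by (simp add: abs_mult)
  qed
  also have "\<dots> = ((\<integral>x. (A x)\<^sup>2 \<partial>M) + mean_sq_degree) / 2" unfolding mean_sq_degree_eq using int by (simp add: d_def)
  finally show ?thesis
    unfolding E3_product[OF bdd_meas2_squares(1) bdd_meas2_kernel] using A2 by (simp add: A_def d_def)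
qed

text \<open>
  The first order terms of the rank one expansion have expectations \<open>0\<close> (from \<open>f\<close>),
  \<open>2 s E d\<^sup>2\<close> (from the residual, whose mean is \<open>E d\<^sup>2 / s\<close>) and two degree covariances, all of
  which are of second order.
\<close>

lemma third_moment_le:
  assumes mean: "E2 f = 0"
  shows "\<bar>E2 (\<lambda>x y. (f x y) ^ 3)\<bar> \<le> 10 / s ^ 3 * spread + 4 / s * mean_sq_residual + 3 * mean_sq_degree"
proof -
  have f3: "bdd_meas2 (\<lambda>x y. (f x y) ^ 3)" unfolding bdd_meas_split2 by (intro bdd_meas bdd_meas_kernel)
  let ?R = "\<lambda>x y z. (f y z) ^ 3 - s\<^sup>2 * f y z - 2 * s\<^sup>2 * residual x y z
      - (((f x y)\<^sup>2 - s\<^sup>2) * f y z + ((f x z)\<^sup>2 - s\<^sup>2) * f y z)"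
  have "\<bar>E3 ?R\<bar> \<le> E3 (\<lambda>x y z. 9 / (2 * s ^ 3) * (((f x y)\<^sup>2 - s\<^sup>2)\<^sup>2 + ((f x z)\<^sup>2 - s\<^sup>2)\<^sup>2)
        + 4 / s * (residual x y z)\<^sup>2)"
  proof (rule E3_abs_le)
    fix x y z
    show "\<bar>?R x y z\<bar> \<le> 9 / (2 * s ^ 3) * (((f x y)\<^sup>2 - s\<^sup>2)\<^sup>2 + ((f x z)\<^sup>2 - s\<^sup>2)\<^sup>2)
        + 4 / s * (residual x y z)\<^sup>2"
      using cube_rank_one_expansion[OF s kernel_bound[of y z] kernel_bound[of x y] kernel_bound[of x z]]
      unfolding residual_def by (simp only: distrib_right)
  qed (unfold bdd_meas_split3, (intro bdd_meas bdd_meas_kernel bdd_meas_residual)+)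
  also have "\<dots> = 9 / (2 * s ^ 3) * (2 * spread) + 4 / s * mean_sq_residual"
    unfolding mean_sq_residual_def by (simp only: E3_linear marginals) simp
  finally have R: "\<bar>E3 ?R\<bar> \<le> 9 / s ^ 3 * spread + 4 / s * mean_sq_residual" by simp
  define C1 where "C1 = E3 (\<lambda>x y z. ((f x y)\<^sup>2 - s\<^sup>2) * f y z)"
  define C2 where "C2 = E3 (\<lambda>x y z. ((f x z)\<^sup>2 - s\<^sup>2) * f y z)"
  have ba: "bdd_meas3 (\<lambda>x y z. ((f x y)\<^sup>2 - s\<^sup>2) * f x z)" unfolding bdd_meas_split3 by (intro bdd_meas bdd_meas_kernel)
  have C1: "C1 = E3 (\<lambda>x y z. ((f x y)\<^sup>2 - s\<^sup>2) * f x z)"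
    unfolding C1_def using E3_permute12[OF ba] by (subst (2) kernel_sym) (simp add: kernel_sym)
  have bc: "bdd_meas3 (\<lambda>x y z. ((f x y)\<^sup>2 - s\<^sup>2) * f y z)" unfolding bdd_meas_split3 by (intro bdd_meas bdd_meas_kernel)
  have C2: "C2 = C1"
    unfolding C2_def C1_def E3_permute23[OF bc, symmetric] by (simp add: kernel_sym)
  have res: "E3 residual = mean_sq_degree / s"
  proof -
    have "E3 residual = E3 (\<lambda>x y z. f y z + 1 / s * (f x y * f x z))"
      by (simp add: residual_def [abs_def])
    also have "\<dots> = 0 + 1 / s * mean_sq_degree" unfolding mean_sq_degree_def
      by (simp only: E3_linear marginals mean)
    finally show ?thesis by simp
  qed
  have "E3 ?R = E2 (\<lambda>x y. (f x y) ^ 3) - s\<^sup>2 * 0 - 2 * s\<^sup>2 * E3 residual - (C1 + C2)"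
    unfolding C1_def C2_def by (simp only: E3_linear marginals mean E3_marginals[OF f3])
  then have "E3 ?R = E2 (\<lambda>x y. (f x y) ^ 3) - 2 * s * mean_sq_degree - 2 * C1"
    unfolding res C2 using s by (simp add: power2_eq_square)
  moreover have "\<bar>2 * C1\<bar> \<le> spread + mean_sq_degree" unfolding C1 using degree_covariance_le by simp
  moreover have "2 * s * mean_sq_degree \<le> 2 * mean_sq_degree" "0 \<le> 2 * s * mean_sq_degree"
    using s mean_sq_degree_nonneg by (simp_all add: mult_left_le_one_le)
  moreover have "spread \<le> 1 / s ^ 3 * spread"
  proof -
    have "1 \<le> 1 / s ^ 3" using s by (simp add: power_le_one)
    moreover have "0 \<le> spread" unfolding spread_def E2_def by (simp add: case_prod_unfold)
    ultimately show ?thesis using mult_right_mono by fastforce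
  qed
  ultimately have "\<bar>E2 (\<lambda>x y. (f x y) ^ 3)\<bar> \<le> 9 / s ^ 3 * spread + 4 / s * mean_sq_residual + 3 * mean_sq_degree + 1 / s ^ 3 * spread"
    using R by linarith
  then show ?thesis by (simp add: field_simps)
qed

text \<open>
  The distance from the bipodal optimum that the entropy bound penalizes.
\<close>

definition "deficit = spread + (energy - s\<^sup>2)"

lemma spread_nonneg: "0 \<le> spread"
  unfolding spread_def E2_def by (simp add: case_prod_unfold)

lemma energy_ge:
  assumes "0 \<le> e" and tri: "triangle_moment = - (s ^ 3) - 3 * e * mean_sq_degree"
  shows "s\<^sup>2 \<le> energy"
proof -
  have "s ^ 3 \<le> s ^ 3 + 3 * e * mean_sq_degree" using assms mean_sq_degree_nonneg by simp
  then have "(s ^ 3)\<^sup>2 \<le> (s ^ 3 + 3 * e * mean_sq_degree)\<^sup>2" using s by (intro power_mono) auto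
  also have "\<dots> = triangle_moment\<^sup>2" unfolding tri by (simp add: power2_eq_square algebra_simps)
  also have "\<dots> \<le> energy ^ 3" by (rule triangle_squared_le)
  finally have "(s\<^sup>2) ^ 3 \<le> energy ^ 3" by (simp flip: power_mult add: mult.commute)
  moreover have "0 \<le> energy" unfolding energy_def E2_def by (simp add: case_prod_unfold)
  ultimately show ?thesis by (meson power_mono_iff zero_less_numeral zero_le_power2)
qed

text \<open>
  With the triangle moment prescribed, the degree term in it changes sides in the bound for the
  residual, which therefore controls both quantities.
\<close>

lemma residual_and_degree_le:
  assumes e: "s \<le> e" and tri: "triangle_moment = - (s ^ 3) - 3 * e * mean_sq_degree"
  shows "mean_sq_residual + 6 * mean_sq_degree \<le> 3 * (energy - s\<^sup>2) + spread / s\<^sup>2"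
proof -
  define Y where "Y = e / s * mean_sq_degree"
  define X where "X = 2 / s * triangle_moment"
  have "X = - 2 * s\<^sup>2 - 6 * Y"
    unfolding X_def Y_def tri using s by (simp add: field_simps power2_eq_square power3_eq_cube)
  moreover have "1 * mean_sq_degree \<le> Y"
    unfolding Y_def by (rule mult_right_mono) (use e s mean_sq_degree_nonneg in auto)
  ultimately show ?thesis using mean_sq_residual_le[folded X_def] by (simp add: algebra_simps)
qed

lemma third_moment_le_deficit:
  assumes mean: "E2 f = 0" and e: "s \<le> e" and tri: "triangle_moment = - (s ^ 3) - 3 * e * mean_sq_degree"
  shows "\<bar>E2 (\<lambda>x y. (f x y) ^ 3)\<bar> \<le> 14 / s ^ 3 * deficit"
proof -
  have s1: "1 \<le> 1 / s" "1 / s \<le> 1 / s ^ 3"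
    using s by (auto simp: divide_simps power_le_one power3_eq_cube mult_le_one)
  have "3 * mean_sq_degree \<le> 4 / s * (6 * mean_sq_degree)"
  proof -
    have "1 * mean_sq_degree \<le> 1 / s * mean_sq_degree" using s1 mean_sq_degree_nonneg by (intro mult_right_mono) auto
    then show ?thesis using mean_sq_degree_nonneg by simp
  qed
  then have "\<bar>E2 (\<lambda>x y. (f x y) ^ 3)\<bar> \<le> 10 / s ^ 3 * spread + 4 / s * (mean_sq_residual + 6 * mean_sq_degree)"
    using third_moment_le[OF mean] by (simp add: algebra_simps)
  also have "\<dots> \<le> 10 / s ^ 3 * spread + 4 / s * (3 * (energy - s\<^sup>2) + spread / s\<^sup>2)"
    using residual_and_degree_le[OF e tri] s by (intro add_left_mono mult_left_mono) auto
  also have "\<dots> = 14 / s ^ 3 * spread + 12 * (1 / s * (energy - s\<^sup>2))"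
    using s by (simp add: field_simps power2_eq_square power3_eq_cube)
  also have "\<dots> \<le> 14 / s ^ 3 * spread + 14 * (1 / s ^ 3 * (energy - s\<^sup>2))"
  proof -
    have "0 \<le> energy - s\<^sup>2" using energy_ge[OF _ tri] e s by simp
    then have "1 / s * (energy - s\<^sup>2) \<le> 1 / s ^ 3 * (energy - s\<^sup>2)" "0 \<le> 1 / s ^ 3 * (energy - s\<^sup>2)"
      using mult_right_mono[OF s1(2)] s by auto
    then show ?thesis by linarith
  qed
  finally show ?thesis unfolding deficit_def distrib_left by simp
qed

text \<open>
  The quartic bound is integrated. Of the two penalty terms, both of size at least \<open>4/3\<close> times their
  part of the deficit, at most one deficit is lost to the third moment; the smallness condition on
  the skewness is chosen for this. A third of the deficit remains.
\<close>

lemma entropy_le_deficit: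
  assumes mean: "E2 f = 0" and tri: "triangle_moment = - (s ^ 3) - 3 * e * mean_sq_degree"
    and range: "\<And>x y. 0 \<le> e + f x y" "\<And>x y. e + f x y \<le> 1"
    and e: "0 < e - s" "e + s < 1"
    and small: "7 * \<bar>skew e s\<bar> < s ^ 5"
  shows "E2 (\<lambda>x y. H (e + f x y)) \<le> (H (e + s) + H (e - s)) / 2 - deficit / 3"
proof -
  define h where "h = (H (e + s) + H (e - s)) / 2"
  define B C K where "B = chord e s" and "C = curvature e s" and "K = skew e s / (2 * s\<^sup>2)"
  have bH: "bdd_meas2 (\<lambda>x y. H (e + f x y))"
  proof -
    have "bounded (H ` {0..1})" by (intro compact_imp_bounded compact_continuous_image continuous_on_H) auto
    then obtain c where c: "\<And>u. u \<in> {0..1} \<Longrightarrow> \<bar>H u\<bar> \<le> c" unfolding bounded_iff by fastforce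
    have [measurable]: "H \<in> borel_measurable borel" unfolding H_def [abs_def] by measurable
    have "(\<lambda>p. H (e + case_prod f p)) \<in> borel_measurable (M \<Otimes>\<^sub>M M)"
      using kernel_measurable by measurable
    then show ?thesis
      unfolding bounded_measurable_def using c range
      by (auto simp: case_prod_unfold intro!: exI[of _ c])
  qed
  define g where "g x y = h + B * f x y - C * ((f x y)\<^sup>2 - s\<^sup>2)
       + K * ((f x y) ^ 3 - s\<^sup>2 * f x y) - 4 / 3 * ((f x y)\<^sup>2 - s\<^sup>2)\<^sup>2" for x y
  have bg: "bdd_meas2 g" unfolding g_def bdd_meas_split2 by (intro bdd_meas bdd_meas_kernel)
  have "E2 (\<lambda>x y. H (e + f x y)) \<le> E2 g"
    unfolding E2_def
  proof (rule integral_mono)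
    fix p assume "p \<in> Sigma_Algebra.space (M \<Otimes>\<^sub>M M)"
    show "(case p of (x, y) \<Rightarrow> H (e + f x y)) \<le> (case p of (x, y) \<Rightarrow> g x y)"
      using entropy_quartic_bound[of s e "e + f (fst p) (snd p)"] range e s
      by (simp add: g_def h_def B_def C_def K_def case_prod_unfold)
  qed (intro MM.bdd_meas_integrable bH bg)+
  also have "E2 g = h - C * (energy - s\<^sup>2) + K * E2 (\<lambda>x y. (f x y) ^ 3) - 4 / 3 * spread"
  proof -
    have f3: "bdd_meas2 (\<lambda>x y. (f x y) ^ 3)" unfolding bdd_meas_split2 by (intro bdd_meas bdd_meas_kernel)
    have "E2 g = E3 (\<lambda>x y z. g x y)" using E3_marginals(1)[OF bg] by simp
    also have "\<dots> = h + B * 0 - C * (energy - s\<^sup>2) + K * (E2 (\<lambda>x y. (f x y) ^ 3) - s\<^sup>2 * 0) - 4 / 3 * spread"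
      unfolding g_def by (simp only: E3_linear marginals mean E3_marginals[OF f3])
    finally show ?thesis by simp
  qed
  also have "\<dots> \<le> h - deficit / 3"
  proof -
    have d: "0 \<le> energy - s\<^sup>2" using energy_ge[OF _ tri] e s by simp
    then have C: "4 / 3 * (energy - s\<^sup>2) \<le> C * (energy - s\<^sup>2)"
      using curvature_ge_2[of s e] s e unfolding C_def by (intro mult_right_mono) auto
    have d0: "0 \<le> deficit" unfolding deficit_def using d spread_nonneg by simp
    \<comment> \<open>The cubic coefficient \<open>K\<close> times the constant of the third moment bound is at most \<open>1\<close>.\<close>
    have "\<bar>K\<bar> * (14 / s ^ 3) = 7 * \<bar>skew e s\<bar> / s ^ 5"
      unfolding K_def using s by (simp add: abs_mult field_simps eval_nat_numeral)
    also have "\<dots> \<le> 1" using small s by simp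
    finally have K1: "\<bar>K\<bar> * (14 / s ^ 3) \<le> 1" .
    have "K * E2 (\<lambda>x y. (f x y) ^ 3) \<le> \<bar>K\<bar> * \<bar>E2 (\<lambda>x y. (f x y) ^ 3)\<bar>"
      by (metis abs_ge_self abs_mult)
    also have "\<dots> \<le> \<bar>K\<bar> * (14 / s ^ 3 * deficit)"
      using third_moment_le_deficit[OF mean _ tri] e by (intro mult_left_mono) auto
    also have "\<dots> \<le> 1 * deficit" using mult_right_mono[OF K1 d0] by (simp add: mult.assoc)
    finally show ?thesis using C unfolding deficit_def by (simp add: field_simps)
  qed
  finally show ?thesis unfolding h_def .
qed

text \<open>
  The terms linear in \<open>f\<close> vanish because the mean does; each of the three quadratic ones is a path
  with two edges, hence a mean square degree.
\<close>

lemma triangle_expansion: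
  assumes mean: "E2 f = 0"
  shows "E3 (\<lambda>x y z. (e + f x y) * (e + f x z) * (e + f y z)) = e ^ 3 + 3 * e * mean_sq_degree + triangle_moment"
proof -
  define D2 where "D2 = E3 (\<lambda>x y z. f x y * f y z)"
  define D3 where "D3 = E3 (\<lambda>x y z. f x z * f y z)"
  have b1: "bdd_meas3 (\<lambda>x y z. f x y * f x z)" unfolding bdd_meas_split3 by (intro bdd_meas bdd_meas_kernel)
  have D2: "D2 = mean_sq_degree"
    unfolding D2_def mean_sq_degree_def using E3_permute12[OF b1] kernel_sym by simp
  have b2: "bdd_meas3 (\<lambda>x y z. f x y * f y z)" unfolding bdd_meas_split3 by (intro bdd_meas bdd_meas_kernel)
  have D3: "D3 = D2"
    unfolding D2_def D3_def using E3_permute23[OF b2] kernel_sym by simp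
  have "E3 (\<lambda>x y z. (e + f x y) * (e + f x z) * (e + f y z)) =
    E3 (\<lambda>x y z. e ^ 3 + e\<^sup>2 * (f x y + f x z + f y z) + e * (f x y * f x z + f x y * f y z + f x z * f y z)
      + f x y * f x z * f y z)"
    by (rule arg_cong[where f = E3]) (auto simp: power2_eq_square power3_eq_cube algebra_simps)
  also have "\<dots> = e ^ 3 + e\<^sup>2 * (0 + 0 + 0) + e * (mean_sq_degree + D2 + D3) + triangle_moment"
    unfolding mean_sq_degree_def triangle_moment_def D2_def D3_def
    by (simp only: E3_linear marginals mean)
  finally show ?thesis unfolding D3 D2 by simp
qed

lemma AE_kernel_of_deficit_le_0:
  assumes e: "s \<le> e" and tri: "triangle_moment = - (s ^ 3) - 3 * e * mean_sq_degree" and d: "deficit \<le> 0"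
  shows "AE p in M \<Otimes>\<^sub>M M \<Otimes>\<^sub>M M. residual (fst p) (fst (snd p)) (snd (snd p)) = 0"
    and "AE p in M \<Otimes>\<^sub>M M. (f (fst p) (snd p))\<^sup>2 = s\<^sup>2"
proof -
  have z: "spread = 0" "energy = s\<^sup>2"
    using d spread_nonneg energy_ge[OF _ tri] e s unfolding deficit_def by auto
  have "mean_sq_residual = 0"
    using residual_and_degree_le[OF e tri] mean_sq_degree_nonneg mean_sq_residual_nonneg z by simp
  moreover have "integrable (M \<Otimes>\<^sub>M M \<Otimes>\<^sub>M M) (\<lambda>p. (residual (fst p) (fst (snd p)) (snd (snd p)))\<^sup>2)"
    by (intro MMM.bdd_meas_integrable bdd_meas bdd_meas_residual)
  ultimately show "AE p in M \<Otimes>\<^sub>M M \<Otimes>\<^sub>M M. residual (fst p) (fst (snd p)) (snd (snd p)) = 0"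
    using integral_nonneg_eq_0_iff_AE[of "M \<Otimes>\<^sub>M M \<Otimes>\<^sub>M M" "\<lambda>p. (residual (fst p) (fst (snd p)) (snd (snd p)))\<^sup>2"]
    unfolding mean_sq_residual_def E3_def by (simp add: case_prod_unfold)
  have "integrable (M \<Otimes>\<^sub>M M) (\<lambda>p. ((f (fst p) (snd p))\<^sup>2 - s\<^sup>2)\<^sup>2)"
    by (intro MM.bdd_meas_integrable bdd_meas bdd_meas_kernel)
  with z(1) show "AE p in M \<Otimes>\<^sub>M M. (f (fst p) (snd p))\<^sup>2 = s\<^sup>2"
    using integral_nonneg_eq_0_iff_AE[of "M \<Otimes>\<^sub>M M" "\<lambda>p. ((f (fst p) (snd p))\<^sup>2 - s\<^sup>2)\<^sup>2"]
    unfolding spread_def E2_def by (simp add: case_prod_unfold)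
qed

text \<open>
  Once the residual is zero almost everywhere, Fubini provides a point \<open>x\<close> for which
  \<open>f(y,z) = - f(x,y) f(x,z) / s\<close> for almost all \<open>y\<close>, \<open>z\<close>, with \<open>f(x,y) = \<plusminus>s\<close>. The set where
  \<open>f(x,y)\<close> is positive is one of the blocks. The mean of \<open>f\<close> is minus the squared mean of that
  row divided by \<open>s\<close>, so the row has mean zero and the blocks have the same measure.
\<close>

lemma two_block_of_deficit_le_0:
  assumes mean: "E2 f = 0" and e: "s \<le> e"
    and tri: "triangle_moment = - (s ^ 3) - 3 * e * mean_sq_degree" and d: "deficit \<le> 0"
  obtains A where "A \<in> sets M" "prob A = 1 / 2"
    "AE p in M \<Otimes>\<^sub>M M. f (fst p) (snd p) = (if fst p \<in> A \<longleftrightarrow> snd p \<in> A then - s else s)"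
proof -
  note ae = AE_kernel_of_deficit_le_0[OF e tri d]
  have "AE p in M \<Otimes>\<^sub>M M \<Otimes>\<^sub>M M. residual (fst p) (fst (snd p)) (snd (snd p)) = 0
     \<and> (f (fst p) (fst (snd p)))\<^sup>2 = s\<^sup>2 \<and> (f (fst p) (snd (snd p)))\<^sup>2 = s\<^sup>2"
    using ae(1) AE_triple[OF ae(2)] by eventually_elim auto
  from MMM.AE_pair[OF this]
  have "AE x in M. x \<in> space M \<and> (AE q in M \<Otimes>\<^sub>M M. residual x (fst q) (snd q) = 0
     \<and> (f x (fst q))\<^sup>2 = s\<^sup>2 \<and> (f x (snd q))\<^sup>2 = s\<^sup>2)"
    by (auto simp: AE_space)
  \<comment> \<open>This \<open>x\<close> is the typical point whose row is frozen.\<close>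
  then obtain x where x: "x \<in> space M" and q: "AE q in M \<Otimes>\<^sub>M M. residual x (fst q) (snd q) = 0
     \<and> (f x (fst q))\<^sup>2 = s\<^sup>2 \<and> (f x (snd q))\<^sup>2 = s\<^sup>2"
    using eventually_happens'[OF ae_filter_bot] by blast
  define v where "v y = f x y" for y
  have bv: "bounded_measurable M v"
    unfolding v_def using bdd_meas_compose[OF bdd_meas2_kernel, of "\<lambda>y. (x, y)" M] x by simp
  then have vm [measurable]: "v \<in> borel_measurable M" unfolding bounded_measurable_def by simp
  define A where "A = {y \<in> space M. 0 < v y}"
  have A: "A \<in> sets M" unfolding A_def by measurable
  have sgn: "v y = (if y \<in> A then s else - s)" if "(v y)\<^sup>2 = s\<^sup>2" "y \<in> space M" for y
    using that s unfolding A_def by (auto simp: power2_eq_iff)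
  have block: "AE p in M \<Otimes>\<^sub>M M. f (fst p) (snd p) = (if fst p \<in> A \<longleftrightarrow> snd p \<in> A then - s else s)"
    using q AE_space
  proof eventually_elim
    case (elim p)
    then have "f (fst p) (snd p) = - (v (fst p) * v (snd p) / s)"
      "v (fst p) = (if fst p \<in> A then s else - s)" "v (snd p) = (if snd p \<in> A then s else - s)"
      using sgn by (auto simp: residual_def v_def space_pair_measure mem_Times_iff)
    then show ?case using s by auto
  qed
  have v_sq: "AE y in M. (v y)\<^sup>2 = s\<^sup>2"
  proof -
    have "AE p in M \<Otimes>\<^sub>M M. (v (fst p))\<^sup>2 = s\<^sup>2" using q by eventually_elim (simp add: v_def)
    from MM.AE_pair[OF this] show ?thesis by (simp add: AE_const)
  qed
  have int_v: "integrable M v" by (rule bdd_meas_integrable[OF bv])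
  have bvv: "bdd_meas2 (\<lambda>y z. - (v y * v z / s))"
    unfolding bdd_meas_split2 by (intro bdd_meas bdd_meas_compose[OF bv]) measurable
  have "E2 f = E2 (\<lambda>y z. - (v y * v z / s))"
    unfolding E2_def
  proof (rule integral_cong_AE)
    show "AE p in M \<Otimes>\<^sub>M M. (case p of (x, y) \<Rightarrow> f x y) = (case p of (y, z) \<Rightarrow> - (v y * v z / s))"
      using q by eventually_elim (auto simp: residual_def v_def case_prod_unfold)
  qed (use kernel_measurable bvv in \<open>auto simp: bounded_measurable_def\<close>)
  also have "\<dots> = - ((\<integral>y. v y \<partial>M) * (\<integral>y. v y \<partial>M) / s)" unfolding E2_iterated[OF bvv] by simp
  finally have "(\<integral>y. v y \<partial>M) = 0" using mean s by simp
  moreover have "(\<integral>y. v y \<partial>M) = (\<integral>y. 2 * s * indicator A y - s \<partial>M)"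
  proof (rule integral_cong_AE)
    show "AE y in M. v y = 2 * s * indicator A y - s"
      using v_sq AE_space by eventually_elim (auto dest: sgn)
  qed (use A in measurable)
  moreover have "(\<integral>y. 2 * s * indicator A y - s \<partial>M) = 2 * s * prob A - s"
    using integrable_real_indicator[OF A] A by (simp add: prob_space less_top[symmetric] sets.Int_space_eq2)
  ultimately have "prob A = 1 / 2" using s by simp
  then show thesis using that[OF A _ block] by simp
qed

end

text \<open>
  The moments of a bipodal kernel with blocks of equal measure. As \<open>\<sigma> x * \<sigma> y\<close> takes two values
  only, \<open>H\<close> of the graphon is an affine function of it, and its mean is zero.
\<close>

lemma (in prob_space) balanced_kernel:
  assumes A: "A \<in> sets M" "prob A = 1 / 2" and s: "0 < s" "s \<le> 1"
  defines "\<sigma> \<equiv> (\<lambda>x. if x \<in> A then 1 else -1 :: real)"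
  defines "f \<equiv> (\<lambda>x y. - s * (\<sigma> x * \<sigma> y))"
  shows "E2 f = 0" "E3 (\<lambda>x y z. (e + f x y) * (e + f x z) * (e + f y z)) = e ^ 3 - s ^ 3"
    "E2 (\<lambda>x y. H (e + f x y)) = (H (e + s) + H (e - s)) / 2"
proof -
  have b\<sigma>: "bounded_measurable M \<sigma>"
    unfolding bounded_measurable_def \<sigma>_def using A by (auto intro!: exI[of _ 1])
  have int\<sigma>: "(\<integral>x. \<sigma> x \<partial>M) = 0"
  proof -
    have "(\<integral>x. \<sigma> x \<partial>M) = (\<integral>x. 2 * indicator A x - 1 \<partial>M)"
      unfolding \<sigma>_def by (rule Bochner_Integration.integral_cong) (auto simp: indicator_def)
    also have "\<dots> = 0" using integrable_real_indicator[OF A(1)] A by (simp add: prob_space less_top[symmetric])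
    finally show ?thesis .
  qed
  have sq: "\<sigma> x * \<sigma> x = 1" for x unfolding \<sigma>_def by simp
  have b2: "bdd_meas2 (\<lambda>x y. c + d * (\<sigma> x * \<sigma> y))" for c d
    unfolding bdd_meas_split2 by (intro bdd_meas bdd_meas_compose[OF b\<sigma>]) measurable
  have E2\<sigma>: "E2 (\<lambda>x y. c + d * (\<sigma> x * \<sigma> y)) = c" for c d
    unfolding E2_iterated[OF b2] by (simp add: int\<sigma> prob_space bdd_meas_integrable[OF b\<sigma>])
  have bf: "bdd_meas2 f" unfolding f_def using b2[of 0 "-s"] by simp
  interpret k: bounded_symmetric_kernel M f s
    using bf s by unfold_locales (auto simp: f_def bounded_measurable_def \<sigma>_def)
  show mean: "E2 f = 0" unfolding f_def using E2\<sigma>[of 0 "-s"] by simp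
  have "k.mean_sq_degree = 0" unfolding k.mean_sq_degree_eq by (simp add: f_def int\<sigma>)
  moreover have "f x y * f x z * f y z = - (s ^ 3)" for x y z
  proof -
    have "f x y * f x z * f y z = - (s ^ 3) * (\<sigma> x * \<sigma> x) * (\<sigma> y * \<sigma> y) * (\<sigma> z * \<sigma> z)"
      unfolding f_def by (simp add: power3_eq_cube)
    then show ?thesis unfolding sq by simp
  qed
  then have "k.triangle_moment = - (s ^ 3)" unfolding k.triangle_moment_def by (simp add: E3_const)
  ultimately show "E3 (\<lambda>x y z. (e + f x y) * (e + f x z) * (e + f y z)) = e ^ 3 - s ^ 3"
    using k.triangle_expansion[OF mean, of e] by simp
  have "H (e + f x y) = (H (e + s) + H (e - s)) / 2 + (H (e - s) - H (e + s)) / 2 * (\<sigma> x * \<sigma> y)" for x y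
    unfolding f_def \<sigma>_def by (auto simp: field_simps)
  then show "E2 (\<lambda>x y. H (e + f x y)) = (H (e + s) + H (e - s)) / 2"
    by (simp only: E2\<sigma>)
qed

section \<open>Lebesgue measure on the unit interval, square and cube\<close>

text \<open>
  Lebesgue-Borel measure carried by \<open>S\<close>, but with all Borel sets of the whole space as measurable
  sets, so that products of such measures are again of this form and measurability of a function
  does not depend on \<open>S\<close>.
\<close>

definition lborel_on :: "'a::euclidean_space set \<Rightarrow> 'a measure" where
  "lborel_on S = density lborel (\<lambda>x. ennreal (indicator S x))"

lemma sets_lborel_on [simp, measurable_cong]: "sets (lborel_on S) = sets borel"
  by (simp add: lborel_on_def)

lemma space_lborel_on [simp]: "space (lborel_on S) = UNIV"
  by (simp add: lborel_on_def)

lemma emeasure_lborel_on: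
  "S \<in> sets borel \<Longrightarrow> A \<in> sets borel \<Longrightarrow> emeasure (lborel_on S) A = emeasure lborel (S \<inter> A)"
  unfolding lborel_on_def
  by (subst emeasure_density) (auto simp: ennreal_indicator indicator_inter_arith[symmetric])

lemma sigma_finite_lborel_on: "S \<in> sets borel \<Longrightarrow> sigma_finite_measure (lborel_on S)"
  unfolding lborel_on_def
  by (subst sigma_finite_measure.sigma_finite_iff_density_finite[OF sigma_finite_lborel]) auto

lemma pair_lborel_on:
  assumes "S \<in> sets borel" "T \<in> sets borel"
  shows "lborel_on S \<Otimes>\<^sub>M lborel_on T = lborel_on (S \<times> T)"
proof -
  have "lborel_on S \<Otimes>\<^sub>M lborel_on T = density (lborel \<Otimes>\<^sub>M lborel)
      (\<lambda>(x, y). ennreal (indicator S x) * ennreal (indicator T y))"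
    unfolding lborel_on_def using assms sigma_finite_lborel_on[OF assms(2)]
    by (intro pair_measure_density sigma_finite_lborel) (auto simp: lborel_on_def)
  also have "(\<lambda>(x, y). ennreal (indicator S x) * ennreal (indicator T y)) = (\<lambda>p. ennreal (indicator (S \<times> T) p))"
    by (auto simp: indicator_def)
  finally show ?thesis by (simp add: lborel_on_def lborel_prod)
qed

lemma integral_lebesgue_on_eq_borel:
  fixes F G :: "'a::euclidean_space \<Rightarrow> real"
  assumes S: "S \<in> sets borel" and G: "G \<in> borel_measurable borel"
    and ae: "AE p in lebesgue_on S. F p = G p"
  shows "integral\<^sup>L (lebesgue_on S) F = integral\<^sup>L (lborel_on S) G"
proof -
  have ae': "AE p in lebesgue. indicator S p *\<^sub>R G p = indicator S p *\<^sub>R F p"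
    using ae S by (simp add: AE_restrict_space_iff) (auto elim!: eventually_mono simp: indicator_def)
  have mG: "(\<lambda>p. indicator S p *\<^sub>R G p) \<in> borel_measurable lborel" using S G by measurable
  then have mG': "(\<lambda>p. indicator S p *\<^sub>R G p) \<in> borel_measurable lebesgue" by (rule measurable_completion)
  have mF: "(\<lambda>p. indicator S p *\<^sub>R F p) \<in> borel_measurable lebesgue"
    by (rule borel_measurable_AE[OF mG' ae'])
  have "integral\<^sup>L (lebesgue_on S) F = (\<integral>p. indicator S p *\<^sub>R F p \<partial>lebesgue)"
    using S by (subst integral_restrict_space) auto
  also have "\<dots> = (\<integral>p. indicator S p *\<^sub>R G p \<partial>lebesgue)"
    by (rule integral_cong_AE[OF mF mG']) (use ae' in eventually_elim, auto)
  also have "\<dots> = (\<integral>p. indicator S p *\<^sub>R G p \<partial>lborel)"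
    by (rule integral_completion[OF mG])
  also have "\<dots> = integral\<^sup>L (lborel_on S) G"
    unfolding lborel_on_def using S G by (subst integral_density) auto
  finally show ?thesis .
qed

lemma AE_lebesgue_on_iff:
  assumes "S \<in> sets borel"
  shows "(AE p in lebesgue_on S. P p) \<longleftrightarrow> (AE p in lborel_on S. P p)"
  unfolding lborel_on_def using assms
  by (simp add: AE_restrict_space_iff AE_completion_iff AE_density indicator_def)

abbreviation unit_lborel :: "real measure" where "unit_lborel \<equiv> lborel_on {0..1}"

interpretation unit: prob_space unit_lborel
  by (rule prob_spaceI) (simp add: emeasure_lborel_on)

lemma AE_lborel_on_iff:
  "S \<in> sets borel \<Longrightarrow> (AE p in lborel_on S. P p) \<longleftrightarrow> (AE p in lborel. p \<in> S \<longrightarrow> P p)"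
  unfolding lborel_on_def by (subst AE_density) (auto simp: indicator_def)

lemma unit_square_lborel: "unit_lborel \<Otimes>\<^sub>M unit_lborel = lborel_on unit_square"
  by (simp add: pair_lborel_on)

lemma unit_cube_lborel: "unit_lborel \<Otimes>\<^sub>M unit_lborel \<Otimes>\<^sub>M unit_lborel = lborel_on unit_cube"
  by (simp add: pair_lborel_on borel_Times)

section \<open>Measure preserving rearrangements\<close>

text \<open>
  Passing from Borel to Lebesgue sets: a map that preserves the measure of Borel sets pulls null sets
  back to null sets, hence also respects the completion.
\<close>

lemma measure_preserving_unitI:
  assumes \<phi>: "\<phi> \<in> borel_measurable borel" "\<And>x. \<phi> x \<in> {0..1}"
    and distr: "distr unit_lborel borel \<phi> = unit_lborel"
  shows "measure_preserving_unit \<phi>"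
proof -
  let ?L = "lebesgue_on {0..1::real}"
  have em: "emeasure lborel ({0..1} \<inter> \<phi> -` B) = emeasure lborel ({0..1} \<inter> B)" if "B \<in> sets borel" for B
  proof -
    have v: "\<phi> -` B \<in> sets borel" using measurable_sets[OF \<phi>(1) that] by simp
    have "emeasure unit_lborel B = emeasure (distr unit_lborel borel \<phi>) B" by (simp only: distr)
    also have "\<dots> = emeasure unit_lborel (\<phi> -` B)" using \<phi>(1) that by (subst emeasure_distr) auto
    finally show ?thesis using that v by (simp add: emeasure_lborel_on)
  qed
  have key: "{0..1} \<inter> \<phi> -` X \<in> sets lebesgue \<and> emeasure lebesgue ({0..1} \<inter> \<phi> -` X) = emeasure lebesgue X"
    if X: "X \<in> sets lebesgue" "X \<subseteq> {0..1}" for X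
  proof -
    obtain B N N' where N: "X = B \<union> N" "N \<subseteq> N'" "N' \<in> null_sets lborel" "B \<in> sets lborel"
      using X(1) by (rule sets_completionE)
    have vB: "\<phi> -` B \<in> sets borel" "\<phi> -` N' \<in> sets borel"
      using measurable_sets[OF \<phi>(1), of B] measurable_sets[OF \<phi>(1), of N'] N by (auto simp: null_sets_def)
    have "emeasure lborel ({0..1} \<inter> \<phi> -` N') \<le> emeasure lborel N'"
      unfolding em[of N', OF null_setsD2[OF N(3), simplified]] by (rule emeasure_mono) (use N in auto)
    then have "{0..1} \<inter> \<phi> -` N' \<in> null_sets lborel" using vB N(3) by (auto simp: null_sets_def)
    then have nullN: "{0..1} \<inter> \<phi> -` N \<in> null_sets lebesgue"
      by (rule null_sets_completion_subset[OF _ null_sets_completionI, rotated]) (use N(2) in auto)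
    have nullN1: "N \<in> null_sets lebesgue"
      by (rule null_sets_completion_subset[OF N(2) null_sets_completionI[OF N(3)]])
    have eq: "{0..1} \<inter> \<phi> -` X = ({0..1} \<inter> \<phi> -` B) \<union> ({0..1} \<inter> \<phi> -` N)" unfolding N(1) by auto
    have sB: "{0..1} \<inter> \<phi> -` B \<in> sets lborel" using vB by simp
    have "emeasure lebesgue ({0..1} \<inter> \<phi> -` X) = emeasure lebesgue ({0..1} \<inter> \<phi> -` B)"
      unfolding eq by (rule emeasure_Un_null_set[OF sets_completionI_sets[OF sB] nullN])
    also have "\<dots> = emeasure lborel ({0..1} \<inter> B)" using sB em[of B] N(4) by simp
    also have "{0..1} \<inter> B = B" using X(2) N(1) by auto
    also have "emeasure lborel B = emeasure lebesgue B" using N(4) by simp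
    also have "\<dots> = emeasure lebesgue X"
      unfolding N(1) by (rule emeasure_Un_null_set[symmetric, OF sets_completionI_sets[OF N(4)] nullN1])
    finally show ?thesis
      unfolding eq using sets_completionI_sets[OF sB] null_setsD2[OF nullN] by auto
  qed
  have m: "\<phi> \<in> measurable ?L ?L"
  proof (rule measurableI)
    fix X assume "X \<in> sets ?L"
    then have "X \<in> sets lebesgue" "X \<subseteq> {0..1}" by (auto simp: sets_restrict_space_iff)
    from key[OF this] show "\<phi> -` X \<inter> space ?L \<in> sets ?L"
      by (simp add: sets_restrict_space_iff Int_commute)
  qed (use \<phi> in auto)
  moreover have "distr ?L ?L \<phi> = ?L"
  proof (rule measure_eqI)
    fix X assume "X \<in> sets (distr ?L ?L \<phi>)"
    then have X: "X \<in> sets ?L" "X \<in> sets lebesgue" "X \<subseteq> {0..1}" by (auto simp: sets_restrict_space_iff)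
    show "emeasure (distr ?L ?L \<phi>) X = emeasure ?L X"
      using key[OF X(2,3)] X m
      by (simp add: emeasure_distr emeasure_restrict_space Int_commute)
  qed simp
  ultimately show ?thesis unfolding measure_preserving_unit_def by simp
qed

text \<open>
  Place \<open>A\<close> on \<open>[0, 1]\<close> and, by a translation by \<open>2\<close>, its complement on \<open>[2, 3]\<close>. The quantile
  function of the resulting distribution pushes the uniform measure forward to it, and by
  monotonicity it sends the lower half of the unit interval to the copy of \<open>A\<close>, which has mass
  \<open>1/2\<close>. Undoing the translation gives the required map.
\<close>

lemma exists_measure_preserving_onto_half:
  assumes A: "A \<in> sets borel" "unit.prob A = 1 / 2"
  obtains \<phi> where "\<phi> \<in> borel_measurable borel" "distr unit_lborel borel \<phi> = unit_lborel"
    "\<And>x. \<phi> x \<in> {0..1}"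
    "AE x in unit_lborel. x \<noteq> 1 / 2 \<and> (\<phi> x \<in> A \<longleftrightarrow> x < 1 / 2)"
proof -
  have [measurable]: "Measurable.pred borel (\<lambda>x. x \<in> A)" using A by simp
  define T where "T x = (if x \<in> A then x else x + 2)" for x :: real
  have T [measurable]: "T \<in> borel_measurable borel" unfolding T_def by measurable
  define \<nu> where "\<nu> = distr unit_lborel borel T"
  interpret \<nu>: prob_space \<nu> unfolding \<nu>_def by (rule unit.prob_space_distr) simp
  interpret \<nu>: cdf_distribution \<nu>
    unfolding cdf_distribution_def real_distribution_def real_distribution_axioms_def
    using \<nu>.prob_space_axioms by (simp add: \<nu>_def)
  have unit_AE: "AE x in unit_lborel. x \<in> {0<..<1} \<and> x \<noteq> 1/2"
    unfolding lborel_on_def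
    using AE_lborel_singleton[of "0::real"] AE_lborel_singleton[of "1::real"] AE_lborel_singleton[of "1/2::real"]
    by (subst AE_density) (auto simp: indicator_def elim: eventually_elim2)
  define J where "J u = (if u \<in> {0<..<1} then \<nu>.I u else 0)" for u
  have J [measurable]: "J \<in> borel_measurable borel"
    unfolding J_def using \<nu>.measurable_CI
    by (subst measurable_If_restrict_space_iff) (simp_all only: Collect_mem_eq, simp_all)
  have J\<nu>: "distr unit_lborel borel J = \<nu>"
  proof (rule measure_eqI)
    fix X assume "X \<in> sets (distr unit_lborel borel J)"
    then have X [measurable]: "X \<in> sets borel" by simp
    let ?R = "restrict_space lborel {0<..<1::real}"
    have vX: "J -` X \<in> sets borel" using measurable_sets[OF J X] by simp
    have mI: "\<nu>.I \<in> borel_measurable ?R"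
      using \<nu>.measurable_CI by (subst measurable_cong_sets[OF sets_restrict_space_cong refl]) auto
    have "emeasure (distr unit_lborel borel J) X = emeasure unit_lborel (J -` X)"
      by (subst emeasure_distr) auto
    also have "\<dots> = emeasure unit_lborel ({0<..<1} \<inter> J -` X)"
      by (rule emeasure_eq_AE) (use unit_AE vX in auto)
    also have "\<dots> = emeasure lborel ({0<..<1} \<inter> J -` X)"
      using vX by (subst emeasure_lborel_on) (auto intro!: arg_cong[where f = "emeasure lborel"])
    also have "\<dots> = emeasure ?R ({0<..<1} \<inter> J -` X)" by (rule emeasure_restrict_space[symmetric]) auto
    also have "{0<..<1} \<inter> J -` X = \<nu>.I -` X \<inter> space ?R" by (auto simp: J_def)
    also have "emeasure ?R (\<nu>.I -` X \<inter> space ?R) = emeasure (distr ?R borel \<nu>.I) X"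
      by (rule emeasure_distr[symmetric, OF mI]) simp
    finally show "emeasure (distr unit_lborel borel J) X = emeasure \<nu> X" unfolding \<nu>.distr_I_eq_M .
  qed (simp add: \<nu>_def)
  have C1: "cdf \<nu> 1 = 1 / 2"
  proof -
    have "cdf \<nu> 1 = unit.prob (T -` {..1})"
      unfolding cdf_def \<nu>_def by (subst measure_distr) auto
    also have "\<dots> = unit.prob A"
    proof (rule measure_eq_AE)
      show "AE x in unit_lborel. x \<in> T -` {..1} \<longleftrightarrow> x \<in> A"
        using unit_AE by eventually_elim (auto simp: T_def)
      show "T -` {..1} \<in> unit.events" using measurable_sets[OF T, of "{..1}"] by simp
    qed (use A in auto)
    finally show ?thesis using A by simp
  qed
  define G where "G = {y. (0 \<le> y \<and> y \<le> 1 \<and> y \<in> A) \<or> (2 \<le> y \<and> y \<le> 3 \<and> y - 2 \<notin> A)}"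
  have G: "AE u in unit_lborel. J u \<in> G"
  proof -
    have "AE x in unit_lborel. T x \<in> G" using unit_AE by eventually_elim (auto simp: T_def G_def)
    moreover have "{y \<in> space borel. y \<in> G} \<in> sets borel" unfolding G_def by measurable
    ultimately have "AE y in \<nu>. y \<in> G" unfolding \<nu>_def by (subst AE_distr_iff) auto
    then show ?thesis unfolding J\<nu>[symmetric] by (rule AE_distrD[rotated]) simp
  qed
  \<comment> \<open>The value \<open>0\<close> outside \<open>[0, 1]\<close> is arbitrary and keeps the range in the unit interval.\<close>
  define fold_back where "fold_back y = (let z = (if y \<le> 1 then y else y - 2) in if z \<in> {0..1} then z else 0)" for y :: real
  have fold_back [measurable]: "fold_back \<in> borel_measurable borel" unfolding fold_back_def Let_def by measurable
  have "distr unit_lborel borel (fold_back \<circ> J) = distr (distr unit_lborel borel J) borel fold_back"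
    by (subst distr_distr) auto
  also have "\<dots> = distr unit_lborel borel (fold_back \<circ> T)"
    unfolding J\<nu> \<nu>_def by (subst distr_distr) auto
  also have "\<dots> = distr unit_lborel borel (\<lambda>x. x)"
  proof (rule distr_cong_AE)
    show "AE x in unit_lborel. (fold_back \<circ> T) x = x"
      using unit_AE by eventually_elim (auto simp: T_def fold_back_def)
  qed auto
  also have "\<dots> = unit_lborel"
    by (rule distr_id2) simp
  finally have distr: "distr unit_lborel borel (fold_back \<circ> J) = unit_lborel" .
  have half: "AE x in unit_lborel. x \<noteq> 1 / 2 \<and> ((fold_back \<circ> J) x \<in> A \<longleftrightarrow> x < 1 / 2)"
    using unit_AE G
  proof eventually_elim
    case (elim u)
    then have "J u \<le> 1 \<longleftrightarrow> u \<le> 1 / 2"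
      using \<nu>.pseudoinverse[of u 1] C1 by (auto simp: J_def)
    then show ?case using elim by (auto simp: fold_back_def G_def Let_def)
  qed
  show thesis
    by (rule that[OF _ distr _ half]) (auto simp: fold_back_def Let_def)
qed

lemma AE_unit_square_pullback:
  assumes \<phi> [measurable]: "\<phi> \<in> borel_measurable borel" and distr: "distr unit_lborel borel \<phi> = unit_lborel"
    and P: "AE p in unit_lborel \<Otimes>\<^sub>M unit_lborel. P (fst p) (snd p)"
  shows "AE p in unit_lborel \<Otimes>\<^sub>M unit_lborel. P (\<phi> (fst p)) (\<phi> (snd p))"
proof -
  have "unit_lborel \<Otimes>\<^sub>M unit_lborel = distr unit_lborel borel \<phi> \<Otimes>\<^sub>M distr unit_lborel borel \<phi>"
    by (simp only: distr)
  also have "\<dots> = distr (unit_lborel \<Otimes>\<^sub>M unit_lborel) (borel \<Otimes>\<^sub>M borel) (\<lambda>(x, y). (\<phi> x, \<phi> y))"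
    by (rule pair_measure_distr) (auto simp: distr sigma_finite_lborel_on)
  finally have "AE p in distr (unit_lborel \<Otimes>\<^sub>M unit_lborel) (borel \<Otimes>\<^sub>M borel) (\<lambda>(x, y). (\<phi> x, \<phi> y)). P (fst p) (snd p)"
    using P by metis
  from AE_distrD[OF _ this] show ?thesis by (simp add: case_prod_unfold)
qed

section \<open>Densities and entropy of graphons\<close>

lemma AE_swap:
  assumes "AE p in unit_lborel \<Otimes>\<^sub>M unit_lborel. P (fst p) (snd p)"
  shows "AE p in unit_lborel \<Otimes>\<^sub>M unit_lborel. P (snd p) (fst p)"
proof -
  interpret pair_sigma_finite unit_lborel unit_lborel ..
  have "AE p in distr (unit_lborel \<Otimes>\<^sub>M unit_lborel) (unit_lborel \<Otimes>\<^sub>M unit_lborel) (\<lambda>(x, y). (y, x)). P (fst p) (snd p)"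
    using assms by (subst (asm) distr_pair_swap)
  from AE_distrD[OF _ this] show ?thesis by (simp add: case_prod_unfold)
qed

text \<open>
  A Borel representative, corrected by symmetrization and truncation so that the properties of a
  graphon hold on the whole plane.
\<close>

lemma graphon_borel_version:
  assumes g: "graphon g"
  obtains F where "(\<lambda>(x, y). F x y) \<in> borel_measurable borel"
    "\<And>x y. F x y = F y x" "\<And>x y. 0 \<le> F x y" "\<And>x y. F x y \<le> 1"
    "AE p in unit_lborel \<Otimes>\<^sub>M unit_lborel. g (fst p) (snd p) = F (fst p) (snd p)"
proof -
  have sq: "unit_square \<in> sets borel" by (simp add: borel_Times)
  have "(\<lambda>p. indicator unit_square p *\<^sub>R (case p of (x, y) \<Rightarrow> g x y)) \<in> borel_measurable lebesgue"
    using g sq unfolding graphon_def by (subst borel_measurable_restrict_space_iff[symmetric]) auto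
  from completion_ex_borel_measurable_real[OF this] obtain G where G: "G \<in> borel_measurable borel"
    and GAE: "AE p in lborel. indicator unit_square p *\<^sub>R (case p of (x, y) \<Rightarrow> g x y) = G p" by auto
  have 1: "AE p in unit_lborel \<Otimes>\<^sub>M unit_lborel. (fst p, snd p) \<in> unit_square \<and> g (fst p) (snd p) = G (fst p, snd p)"
    unfolding unit_square_lborel AE_lborel_on_iff[OF sq] using GAE by eventually_elim auto
  define F where "F x y = min 1 (max 0 ((G (x, y) + G (y, x)) / 2))" for x y
  have "(\<lambda>p. F (fst p) (snd p)) \<in> borel_measurable borel"
  proof -
    have [measurable]: "G \<in> borel_measurable (borel \<Otimes>\<^sub>M borel)" using G by (simp add: borel_prod)
    have "(\<lambda>p. F (fst p) (snd p)) \<in> borel_measurable (borel \<Otimes>\<^sub>M borel)" unfolding F_def by measurable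
    then show ?thesis by (simp add: borel_prod)
  qed
  then have "(\<lambda>(x, y). F x y) \<in> borel_measurable borel" by (simp add: case_prod_unfold)
  moreover have "F x y = F y x" "0 \<le> F x y" "F x y \<le> 1" for x y
    unfolding F_def by (auto simp: add.commute)
  moreover have "AE p in unit_lborel \<Otimes>\<^sub>M unit_lborel. g (fst p) (snd p) = F (fst p) (snd p)"
    using 1 AE_swap[OF 1]
  proof eventually_elim
    case (elim p)
    then have "fst p \<in> {0..1}" "snd p \<in> {0..1}" by auto
    then have g': "g (fst p) (snd p) = g (snd p) (fst p)" "0 \<le> g (fst p) (snd p)" "g (fst p) (snd p) \<le> 1"
      using g unfolding graphon_def by blast+
    have "(G (fst p, snd p) + G (snd p, fst p)) / 2 = g (fst p) (snd p)" using elim g'(1) by simp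
    then show ?case unfolding F_def using g'(2,3) by simp
  qed
  ultimately show thesis by (rule that)
qed

lemma bdd_meas2_borel:
  assumes "(\<lambda>(x, y). F x y) \<in> borel_measurable borel" "\<And>x y. \<bar>F x y\<bar> \<le> c"
  shows "unit.bdd_meas2 F"
  unfolding bounded_measurable_def using assms
  by (auto simp: unit_square_lborel intro!: exI[of _ c])

text \<open>
  This moves the integrals from the completed Lebesgue measure of the square and the cube to product
  measures, where points of the unit interval can be treated as independent.
\<close>

lemma densities_of_borel_version:
  assumes F: "(\<lambda>(x, y). F x y) \<in> borel_measurable borel" "\<And>x y. 0 \<le> F x y" "\<And>x y. F x y \<le> 1"
    and sym: "\<And>x y. x \<in> {0..1} \<Longrightarrow> y \<in> {0..1} \<Longrightarrow> g x y = g y x"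
    and ae: "AE p in unit_lborel \<Otimes>\<^sub>M unit_lborel. g (fst p) (snd p) = F (fst p) (snd p)"
  shows "edge_density g = unit.E2 F"
    and "triangle_density g = unit.E3 (\<lambda>x y z. F x y * F x z * F y z)"
    and "graphon_entropy g = unit.E2 (\<lambda>x y. H (F x y))"
proof -
  have sq: "unit_square \<in> sets borel" and cube: "unit_cube \<in> sets borel" by (simp_all add: borel_Times)
  have ae_sq: "AE p in lebesgue_on unit_square. g (fst p) (snd p) = F (fst p) (snd p)"
    unfolding AE_lebesgue_on_iff[OF sq] using ae unfolding unit_square_lborel .
  show "edge_density g = unit.E2 F"
    unfolding edge_density_def unit.E2_def unit_square_lborel
    by (rule integral_lebesgue_on_eq_borel[OF sq F(1)]) (use ae_sq in \<open>simp add: case_prod_unfold\<close>)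
  have [measurable]: "H \<in> borel_measurable borel" unfolding H_def [abs_def] by measurable
  have "(\<lambda>p. H (case_prod F p)) \<in> borel_measurable borel" using F(1) by measurable
  then have HF: "(\<lambda>(x, y). H (F x y)) \<in> borel_measurable borel" by (simp add: case_prod_unfold)
  show "graphon_entropy g = unit.E2 (\<lambda>x y. H (F x y))"
    unfolding graphon_entropy_def unit.E2_def unit_square_lborel
    by (rule integral_lebesgue_on_eq_borel[OF sq HF]) (use ae_sq in \<open>auto simp: case_prod_unfold elim: eventually_mono\<close>)
  have bF: "unit.bdd_meas2 F" by (rule bdd_meas2_borel[OF F(1), of 1]) (use F in auto)
  have b: "unit.bdd_meas3 (\<lambda>x y z. F x y * F x z * F y z)"
    using unit.bdd_meas3_pair[OF bF] unfolding unit.bdd_meas_split3 by (intro bdd_meas)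
  then have m: "(\<lambda>(x, y, z). F x y * F x z * F y z) \<in> borel_measurable borel"
    unfolding bounded_measurable_def unit_cube_lborel measurable_cong_sets[OF sets_lborel_on refl] by blast
  have "AE p in lborel_on unit_cube. g (fst p) (fst (snd p)) = F (fst p) (fst (snd p)) \<and>
    g (fst p) (snd (snd p)) = F (fst p) (snd (snd p)) \<and>
    g (fst (snd p)) (snd (snd p)) = F (fst (snd p)) (snd (snd p))"
    using unit.AE_triple[OF ae] unfolding unit_cube_lborel .
  moreover have "AE p in lborel_on unit_cube. p \<in> unit_cube" by (simp add: AE_lborel_on_iff[OF cube])
  ultimately have "AE p in lborel_on unit_cube. (case p of (x, y, z) \<Rightarrow> g x y * g y z * g z x) =
      (case p of (x, y, z) \<Rightarrow> F x y * F x z * F y z)"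
  proof eventually_elim
    case (elim p)
    moreover obtain x y z where "p = (x, y, z)" by (cases p)
    ultimately show ?case using sym[of z x] by simp
  qed
  then show "triangle_density g = unit.E3 (\<lambda>x y z. F x y * F x z * F y z)"
    unfolding triangle_density_def unit.E3_def unit_cube_lborel
    by (intro integral_lebesgue_on_eq_borel[OF cube m]) (simp add: AE_lebesgue_on_iff[OF cube])
qed

section \<open>The symmetric bipodal region\<close>

text \<open>
  The conditions say in turn that the gap \<open>s = root 3 (e ^ 3 - t)\<close> is smaller than \<open>e\<close> and
  positive, that \<open>e + s < 1\<close>, so that both values of the bipodal graphon are interior, and that
  the cubic term of the entropy bound is dominated by the deficit.
\<close>

definition symmetric_bipodal_region :: "(real \<times> real) set" where
  "symmetric_bipodal_region = {(e, t). 0 < t \<and> t < e ^ 3 \<and> e + root 3 (e ^ 3 - t) < 1 \<and>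
      7 * \<bar>skew e (root 3 (e ^ 3 - t))\<bar> < root 3 (e ^ 3 - t) ^ 5}"

text \<open>
  The gap \<open>s\<close> is half of the difference between the two values of the bipodal graphon.
\<close>

lemma region_gap:
  fixes e t :: real
  assumes "0 < t" "t < e ^ 3"
  defines "s \<equiv> root 3 (e ^ 3 - t)"
  shows "0 < s" "s < e" "s ^ 3 = e ^ 3 - t"
proof -
  show "0 < s" using assms by (simp add: s_def)
  have "s < root 3 (e ^ 3)" unfolding s_def using assms by (intro real_root_less_mono) auto
  then show "s < e" by (simp add: odd_real_root_power_cancel)
  show "s ^ 3 = e ^ 3 - t" unfolding s_def by (rule odd_real_root_pow) simp
qed

text \<open>
  The kernel inequalities applied to a centred Borel representative of \<open>g\<close>. In the case of equality
  the deficit is zero, \<open>g\<close> has two blocks \<open>A\<close> and its complement, and a map that sends the lower half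
  of the unit interval to \<open>A\<close> pulls \<open>g\<close> back to the bipodal graphon.
\<close>

lemma entropy_bound_and_rigidity:
  assumes et: "(e, t) \<in> symmetric_bipodal_region" and g: "graphon g"
    and dens: "edge_density g = e" "triangle_density g = t"
  defines "s \<equiv> root 3 (e ^ 3 - t)"
  shows "graphon_entropy g \<le> (H (e + s) + H (e - s)) / 2"
    and "(H (e + s) + H (e - s)) / 2 \<le> graphon_entropy g \<Longrightarrow>
      \<exists>\<phi>. measure_preserving_unit \<phi> \<and>
        (AE (x, y) in lebesgue_on unit_square. g (\<phi> x) (\<phi> y) = bipodal e t x y)"
proof -
  have reg: "0 < t" "t < e ^ 3" "e + s < 1" "7 * \<bar>skew e s\<bar> < s ^ 5"
    using et unfolding symmetric_bipodal_region_def s_def by auto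
  note gap = region_gap[OF reg(1,2), folded s_def]
  obtain F where F: "(\<lambda>(x, y). F x y) \<in> borel_measurable borel"
    "\<And>x y. F x y = F y x" "\<And>x y. 0 \<le> F x y" "\<And>x y. F x y \<le> 1"
    and ae: "AE p in unit_lborel \<Otimes>\<^sub>M unit_lborel. g (fst p) (snd p) = F (fst p) (snd p)"
    by (rule graphon_borel_version[OF g]) blast
  have sym: "\<And>x y. x \<in> {0..1} \<Longrightarrow> y \<in> {0..1} \<Longrightarrow> g x y = g y x" using g unfolding graphon_def by blast
  note dF = densities_of_borel_version[OF F(1,3,4) sym ae]
  define f where "f x y = F x y - e" for x y
  have Ff: "F x y = e + f x y" for x y unfolding f_def by simp
  have bF: "unit.bdd_meas2 F" by (rule bdd_meas2_borel[OF F(1), of 1]) (use F in auto)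
  have bf: "unit.bdd_meas2 f" using bF unfolding f_def unit.bdd_meas_split2 by (intro bdd_meas)
  have fb: "\<bar>f x y\<bar> \<le> 1" for x y
    unfolding f_def abs_le_iff using F(3)[of x y] F(4)[of x y] gap reg(3) by auto
  interpret k: bounded_symmetric_kernel unit_lborel f s
    using bf F(2) fb gap reg(3) by unfold_locales (auto simp: f_def bounded_measurable_def)
  have mean: "unit.E2 f = 0"
  proof -
    have "unit.E3 (\<lambda>x y z. F x y - e) = unit.E2 F - e"
      using unit.bdd_meas3_pair[OF bF] unit.E3_marginals[OF bF]
      by (subst unit.E3_diff) (auto simp: unit.E3_const unit.bdd_meas_split3 intro: bdd_meas)
    then show ?thesis using unit.E3_marginals(1)[OF bf] dF(1) dens by (simp add: f_def [abs_def])
  qed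
  have tri: "k.triangle_moment = - (s ^ 3) - 3 * e * k.mean_sq_degree"
    using k.triangle_expansion[OF mean, of e] dF(2) dens gap(3) unfolding Ff by simp
  have "unit.E2 (\<lambda>x y. H (e + f x y)) \<le> (H (e + s) + H (e - s)) / 2 - k.deficit / 3"
    by (rule k.entropy_le_deficit[OF mean tri]) (use F gap reg in \<open>auto simp flip: Ff\<close>)
  then have ent: "graphon_entropy g \<le> (H (e + s) + H (e - s)) / 2 - k.deficit / 3"
    using dF(3) by (simp add: Ff)
  have "0 \<le> k.deficit"
    unfolding k.deficit_def using k.spread_nonneg k.energy_ge[OF _ tri] gap by simp
  then have "c - k.deficit / 3 \<le> c" for c by simp
  with ent show "graphon_entropy g \<le> (H (e + s) + H (e - s)) / 2" by (rule order_trans)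
  assume "(H (e + s) + H (e - s)) / 2 \<le> graphon_entropy g"
  moreover have "c \<le> c - k.deficit / 3 \<Longrightarrow> k.deficit \<le> 0" for c by simp
  ultimately have d: "k.deficit \<le> 0" using ent by (meson order_trans)
  obtain A where A: "A \<in> unit.events" "unit.prob A = 1 / 2"
    and block: "AE p in unit_lborel \<Otimes>\<^sub>M unit_lborel.
      f (fst p) (snd p) = (if fst p \<in> A \<longleftrightarrow> snd p \<in> A then - s else s)"
    using k.two_block_of_deficit_le_0[OF mean _ tri d] gap by auto
  obtain \<phi> where \<phi>: "\<phi> \<in> borel_measurable borel" "distr unit_lborel borel \<phi> = unit_lborel"
    "\<And>x. \<phi> x \<in> {0..1}" "AE x in unit_lborel. x \<noteq> 1 / 2 \<and> (\<phi> x \<in> A \<longleftrightarrow> x < 1 / 2)"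
    using exists_measure_preserving_onto_half[of A] A by auto
  have gblock: "AE p in unit_lborel \<Otimes>\<^sub>M unit_lborel.
      g (fst p) (snd p) = (if fst p \<in> A \<longleftrightarrow> snd p \<in> A then e - s else e + s)"
    using ae block by eventually_elim (auto simp: f_def)
  have "AE p in unit_lborel \<Otimes>\<^sub>M unit_lborel. g (\<phi> (fst p)) (\<phi> (snd p)) = bipodal e t (fst p) (snd p)"
    using AE_unit_square_pullback[OF \<phi>(1,2) gblock] unit.AE_both[OF \<phi>(4)]
    by eventually_elim (auto simp: bipodal_def s_def)
  then have "AE (x, y) in lebesgue_on unit_square. g (\<phi> x) (\<phi> y) = bipodal e t x y"
    unfolding unit_square_lborel by (subst AE_lebesgue_on_iff) (simp_all add: borel_Times case_prod_unfold)
  then show "\<exists>\<phi>. measure_preserving_unit \<phi> \<and>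
        (AE (x, y) in lebesgue_on unit_square. g (\<phi> x) (\<phi> y) = bipodal e t x y)"
    using measure_preserving_unitI[OF \<phi>(1,3,2)] by blast
qed

lemma bipodal_densities:
  assumes et: "0 < t" "t < e ^ 3" "e + root 3 (e ^ 3 - t) < 1"
  defines "s \<equiv> root 3 (e ^ 3 - t)"
  shows "graphon (bipodal e t)" "edge_density (bipodal e t) = e" "triangle_density (bipodal e t) = t"
    "graphon_entropy (bipodal e t) = (H (e + s) + H (e - s)) / 2"
proof -
  note gap = region_gap[OF et(1,2), folded s_def]
  have bip: "bipodal e t x y = (if x < 1/2 \<and> y < 1/2 \<or> 1/2 < x \<and> 1/2 < y then e - s else e + s)" for x y
    unfolding bipodal_def s_def ..
  have sym: "bipodal e t x y = bipodal e t y x" for x y unfolding bip by auto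
  have "(\<lambda>p. bipodal e t (fst p) (snd p)) \<in> borel_measurable (borel \<Otimes>\<^sub>M borel)" unfolding bip by measurable
  then have m: "(\<lambda>(x, y). bipodal e t x y) \<in> borel_measurable borel" by (simp add: borel_prod case_prod_unfold)
  then have "(\<lambda>(x, y). bipodal e t x y) \<in> borel_measurable lborel" by simp
  from measurable_restrict_space1[OF measurable_completion[OF this]]
  have "(\<lambda>(x, y). bipodal e t x y) \<in> borel_measurable (lebesgue_on unit_square)" .
  moreover have "0 \<le> bipodal e t x y \<and> bipodal e t x y \<le> 1" for x y
    unfolding bip using gap et(3) by (auto simp: s_def[symmetric])
  ultimately show "graphon (bipodal e t)"
    unfolding graphon_def using sym by blast
  \<comment> \<open>The rank one model differs from \<open>bipodal e t\<close> only where a coordinate equals \<open>1/2\<close>.\<close>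
  define \<sigma> where "\<sigma> x = (if x \<in> {..<1/2} then 1 else -1 :: real)" for x :: real
  define f where "f x y = - s * (\<sigma> x * \<sigma> y)" for x y
  have half: "{..<1/2::real} \<in> unit.events" "unit.prob {..<1/2} = 1 / 2"
  proof -
    have "{0..1} \<inter> {..<1/2} = {0..<1/2::real}" by auto
    then have "emeasure unit_lborel {..<1/2} = ennreal (1 / 2 - 0)"
      by (simp only: emeasure_lborel_on borel_open borel_closed open_lessThan closed_atLeastAtMost)
         (rule emeasure_lborel_Ico, simp)
    then show "unit.prob {..<1/2} = 1 / 2" unfolding measure_def by (simp only:) (subst enn2real_ennreal, simp_all)
  qed simp
  have s1: "s \<le> 1" using gap et(3)[folded s_def] by linarith
  note bal = unit.balanced_kernel[OF half gap(1) s1, folded \<sigma>_def f_def]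
  have "(\<lambda>p. e + f (fst p) (snd p)) \<in> borel_measurable (borel \<Otimes>\<^sub>M borel)" unfolding f_def \<sigma>_def by measurable
  then have mf: "(\<lambda>(x, y). e + f x y) \<in> borel_measurable borel" by (simp add: borel_prod case_prod_unfold)
  have r: "0 \<le> e + f x y" "e + f x y \<le> 1" for x y
    unfolding f_def \<sigma>_def using gap et(3) by (auto simp: s_def[symmetric])
  have fe: "f x y = (e + f x y) - e" for x y by simp
  have "AE x in unit_lborel. x \<noteq> 1/2"
    by (subst AE_lborel_on_iff) (auto intro: eventually_mono[OF AE_lborel_singleton[of "1/2::real"]])
  from unit.AE_both[OF this]
  have ae: "AE p in unit_lborel \<Otimes>\<^sub>M unit_lborel. bipodal e t (fst p) (snd p) = e + f (fst p) (snd p)"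
    by eventually_elim (auto simp: bip f_def \<sigma>_def)
  note d = densities_of_borel_version[OF mf r sym ae]
  have bef: "unit.bdd_meas2 (\<lambda>x y. e + f x y)"
    by (rule bdd_meas2_borel[OF mf, of 1]) (use r in \<open>auto simp: abs_le_iff intro: order_trans\<close>)
  have bf: "unit.bdd_meas2 f"
    unfolding unit.bdd_meas_split2 by (subst fe) (intro bdd_meas bef[unfolded unit.bdd_meas_split2])
  show "triangle_density (bipodal e t) = t" unfolding d(2) bal(2) using gap(3) by simp
  show "graphon_entropy (bipodal e t) = (H (e + s) + H (e - s)) / 2" unfolding d(3) bal(3) ..
  have "unit.E2 (\<lambda>x y. e + f x y) = unit.E3 (\<lambda>x y z. e + f x y)"
    by (rule unit.E3_marginals(1)[symmetric, OF bef])
  also have "\<dots> = e + unit.E2 f"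
    using unit.bdd_meas3_pair[OF bf] unit.E3_marginals[OF bf]
    by (subst unit.E3_add) (auto simp: unit.E3_const unit.bdd_meas_split3 intro: bdd_meas)
  finally show "edge_density (bipodal e t) = e" unfolding d(1) bal(1) by simp
qed

text \<open>
  The first three conditions define an open set \<open>V\<close> on which \<open>s\<close> and the arguments of the logarithms
  in the skewness are positive, so that the fourth condition is continuous there.
\<close>

lemma open_symmetric_bipodal_region: "open symmetric_bipodal_region"
proof -
  define s where "s p = root 3 (fst p ^ 3 - snd p)" for p :: "real \<times> real"
  define V where "V = {p :: real \<times> real. 0 < snd p} \<inter> {p. snd p < fst p ^ 3} \<inter> {p. fst p + s p < 1}"
  have cs: "continuous_on A s" for A unfolding s_def by (intro continuous_intros)
  have oV: "open V"
    unfolding V_def by (intro open_Int open_Collect_less continuous_intros cs)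
  have pos: "0 < s p" "0 < fst p - s p" "fst p + s p < 1" "0 < fst p + s p" "fst p - s p < 1" if "p \<in> V" for p
  proof -
    have V: "0 < snd p" "snd p < fst p ^ 3" "fst p + s p < 1" using that unfolding V_def by auto
    from region_gap[OF V(1,2)] have "0 < s p" "s p < fst p" unfolding s_def by auto
    with V(3) show "0 < s p" "0 < fst p - s p" "fst p + s p < 1" "0 < fst p + s p" "fst p - s p < 1" by linarith+
  qed
  have "continuous_on V (\<lambda>p. s p ^ 5 - 7 * \<bar>skew (fst p) (s p)\<bar>)"
    unfolding skew_def logit_def H_def
    by (intro continuous_intros cs) (use pos in \<open>fastforce+\<close>)
  from continuous_open_preimage[OF this oV open_greaterThan[of 0]]
  have "open (V \<inter> (\<lambda>p. s p ^ 5 - 7 * \<bar>skew (fst p) (s p)\<bar>) -` {0<..})" .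
  also have "V \<inter> (\<lambda>p. s p ^ 5 - 7 * \<bar>skew (fst p) (s p)\<bar>) -` {0<..} = symmetric_bipodal_region"
    unfolding V_def s_def symmetric_bipodal_region_def by auto
  finally show ?thesis .
qed

lemma segment_subset_region:
  "{(e, t). e = 1/2 \<and> 0 < t \<and> t < 1/8} \<subseteq> symmetric_bipodal_region"
proof clarify
  fix t :: real assume t: "0 < t" "t < 1/8"
  define s where "s = root 3 ((1/2) ^ 3 - t)"
  have t': "t < (1/2) ^ 3" using t by (simp add: power3_eq_cube)
  note gap = region_gap[OF t(1) t', folded s_def]
  have "H (1/2 + s) = H (1/2 - s)" unfolding H_def by simp
  moreover have "logit (1/2 + s) = - logit (1/2 - s)" unfolding logit_def by simp
  ultimately have "skew (1/2) s = 0" unfolding skew_def by simp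
  then show "(1/2, t) \<in> symmetric_bipodal_region"
    unfolding symmetric_bipodal_region_def using gap t t' by (simp add: s_def[symmetric])
qed

theorem theorem1:
  "\<exists>U :: (real \<times> real) set.
     open U \<and> {(e, t). e = 1/2 \<and> 0 < t \<and> t < 1/8} \<subseteq> U \<and>
     (\<forall>(e, t)\<in>U.
        entropy_maximizer e t (bipodal e t) \<and>
        (\<forall>g h. entropy_maximizer e t g \<and> entropy_maximizer e t h \<longrightarrow> graphon_equiv g h))"
proof (intro exI[of _ symmetric_bipodal_region] conjI open_symmetric_bipodal_region segment_subset_region)
  have "entropy_maximizer e t (bipodal e t) \<and>
        (\<forall>g h. entropy_maximizer e t g \<and> entropy_maximizer e t h \<longrightarrow> graphon_equiv g h)"
    if et: "(e, t) \<in> symmetric_bipodal_region" for e t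
  proof
    define s where "s = root 3 (e ^ 3 - t)"
    have "0 < t" "t < e ^ 3" "e + root 3 (e ^ 3 - t) < 1"
      using et unfolding symmetric_bipodal_region_def by auto
    note bip = bipodal_densities[OF this]
    show "entropy_maximizer e t (bipodal e t)"
      unfolding entropy_maximizer_def bip(4) using bip(1-3) entropy_bound_and_rigidity(1)[OF et] by blast
    have model: "\<exists>\<phi>. measure_preserving_unit \<phi> \<and>
        (AE (x, y) in lebesgue_on unit_square. g (\<phi> x) (\<phi> y) = bipodal e t x y)"
      if "entropy_maximizer e t g" for g
    proof (rule entropy_bound_and_rigidity(2)[OF et])
      show "graphon g" "edge_density g = e" "triangle_density g = t"
        using that unfolding entropy_maximizer_def by auto
      have "graphon_entropy (bipodal e t) \<le> graphon_entropy g"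
        using that bip(1-3) unfolding entropy_maximizer_def by blast
      then show "(H (e + root 3 (e ^ 3 - t)) + H (e - root 3 (e ^ 3 - t))) / 2 \<le> graphon_entropy g"
        unfolding bip(4) .
    qed
    show "\<forall>g h. entropy_maximizer e t g \<and> entropy_maximizer e t h \<longrightarrow> graphon_equiv g h"
    proof (intro allI impI, elim conjE)
      fix g h assume gh: "entropy_maximizer e t g" "entropy_maximizer e t h"
      obtain \<phi> \<psi> where mp: "measure_preserving_unit \<phi>" "measure_preserving_unit \<psi>"
        and ae: "AE (x, y) in lebesgue_on unit_square. g (\<phi> x) (\<phi> y) = bipodal e t x y"
          "AE (x, y) in lebesgue_on unit_square. h (\<psi> x) (\<psi> y) = bipodal e t x y"
        using model[OF gh(1)] model[OF gh(2)] by blast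
      have "AE (x, y) in lebesgue_on unit_square. g (\<phi> x) (\<phi> y) = h (\<psi> x) (\<psi> y)"
        using ae by eventually_elim auto
      with mp show "graphon_equiv g h" unfolding graphon_equiv_def by blast
    qed
  qed
  then show "\<forall>(e, t)\<in>symmetric_bipodal_region. entropy_maximizer e t (bipodal e t) \<and>
        (\<forall>g h. entropy_maximizer e t g \<and> entropy_maximizer e t h \<longrightarrow> graphon_equiv g h)"
    by auto
qed

end
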